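(* The $A(\mathscr{T}^+)$-bimodule $A(\mathscr{T}_t^+)$ is generated by $[|\theta\rangle]$, and the $A(\mathscr{T}^+)$-bimodule $A(\mathscr{T}_t^-)$ is generated by $[e_{(-\frac12)}|\theta\rangle]$ and $[f_{(-\frac12)}|\theta\rangle]$, where $[u]$ denotes the class of $u$ modulo $O(\mathscr{T}_t^\pm)$.
   Context: Symplectic fermions. Let $\mathfrak{h}=\mathbb{C}e\oplus\mathbb{C}f$ carry the skew-symmetric form with $\langle e,e\rangle=\langle f,f\rangle=0$, $\langle e,f\rangle=-1$. Let $\hat{\mathfrak h}=\mathfrak{h}\otimes\mathbb{C}[t,t^{-1}]\oplus\mathbb{C}K$ be the Lie superalgebra with even part $\mathbb{C}K$ ($K$ central), odd part $\mathfrak{h}\otimes\mathbb{C}[t,t^{-1}]$ and $[\phi\otimes t^m,\psi\otimes t^n]_+=m\langle\phi,\psi\rangle\delta_{m+n,0}K$. Let $\mathscr{T}$ be the $\hat{\mathfrak h}$-module induced from the one-dimensional module of $\mathfrak{h}\otimes\mathbb{C}[t]\oplus\mathbb{C}K$ on which $\mathfrak{h}\otimes\mathbb{C}[t]$ acts by $0$ and $K$ by $1$; let $|0\rangle$ be its generator and $h_{(n)}$ the action of $h\otimes t^n$. $\mathscr{T}$ is spanned by $v=h^1_{(-n_1)}\cdots h^r_{(-n_r)}|0\rangle$ ($h^i\in\mathfrak{h}$, $n_i\in\mathbb{Z}_{>0}$, $r\ge0$), of weight $n_1+\cdots+n_r$; $\mathscr{T}^+$ (resp. $\mathscr{T}^-$)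 is the span of those with $r$ even (resp. odd). $\mathscr{T}$ is a simple vertex operator superalgebra with even part $\mathscr{T}^+$ and odd part $\mathscr{T}^-$, vacuum $|0\rangle$, Virasoro element $\omega=e_{(-1)}f_{(-1)}|0\rangle$ (central charge $-2$), and $Y(v,z)={:}\partial^{(n_1-1)}h^1(z)\cdots\partial^{(n_r-1)}h^r(z){:}$ for $v=h^1_{(-n_1)}\cdots h^r_{(-n_r)}|0\rangle$, where $h(z)=\sum_{n\in\mathbb{Z}}h_{(n)}z^{-n-1}$, $\partial^{(k)}=\frac1{k!}(d/dz)^k$, and normal ordering is defined recursively by ${:}h^1_{(m_1)}\cdots h^r_{(m_r)}{:}=h^1_{(m_1)}{:}h^2_{(m_2)}\cdots h^r_{(m_r)}{:}$ if $m_1<0$ and $(-1)^{r-1}{:}h^2_{(m_2)}\cdots h^r_{(m_r)}{:}h^1_{(m_1)}$ if $m_1\ge0$. Thus $\mathscr{T}^+$ is a vertex operator algebra. Twisted sector. Let $\hat{\mathfrak h}_\theta=\mathfrak{h}\otimes t^{1/2}\mathbb{C}[t,t^{-1}]\oplus\mathbb{C}K$ with the same bracket formula ($m,n\in\frac12+\mathbb{Z}$, $K$ central), and let $\mathscr{T}_t$ be induced from the one-dimensional module $\mathbb{C}|\theta\rangle$ of $\mathfrak{h}\otimes t^{1/2}\mathbb{C}[t]\oplus\mathbb{C}K$ on which $\mathfrak{h}\otimes t^{1/2}\mathbb{C}[t]$ acts by $0$ and $K$ by $1$. Write $h_{(n)}$ for the action of $h\otimes t^n$ and $h(z)=\sum_{n\in\frac12+\mathbb{Z}}h_{(n)}z^{-n-1}$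 on $\mathscr{T}_t$; define $W(v,z)$ on $\mathscr{T}_t$ by the same normally ordered formula as $Y(v,z)$. Put $\Delta(z)=2\sum_{m,n\ge0}c_{mn}e_{(m)}f_{(n)}z^{-m-n}$ (acting on $\mathscr{T}$), where $\sum_{m,n\ge0}c_{mn}x^my^n=-\log\bigl(\frac{(1+x)^{1/2}+(1+y)^{1/2}}{2}\bigr)$, and $Y^\theta(v,z)=W(e^{\Delta(z)}v,z)$. With $\theta=\pm1$ on $\mathscr{T}^\pm$, $(\mathscr{T}_t,Y^\theta)$ is a $\theta$-twisted $\mathscr{T}$-module. $\mathscr{T}_t^+$ (resp. $\mathscr{T}_t^-$) is the span of $h^1_{(-n_1)}\cdots h^r_{(-n_r)}|\theta\rangle$, $n_i\in\frac12+\mathbb{Z}_{\ge0}$, with $r$ even (resp. odd); both are $\mathscr{T}^+$-modules via $Y^\theta(a,z)=\sum_{n\in\mathbb{Z}}a_{(n)}z^{-n-1}$ ($a\in\mathscr{T}^+$). Zhu algebra and Frenkel–Zhu bimodules. For a vertex operator algebra $V$, a $V$-module $M$, homogeneous $a\in V$ of weight $|a|$ and $u\in M$, put $a\circ u=\sum_{i\ge0}\binom{|a|}{i}a_{(i-2)}u$, $a*u=\sum_{i\ge0}\binom{|a|}{i}a_{(i-1)}u$, $u*a=\sum_{i\ge0}\binom{|a|-1}{i}a_{(i-1)}u$, extended linearly in $a$. Let $O(M)$ be the span of all $a\circ u$ and $A(M)=M/O(M)$. Then $A(V)$ is an associative algebra under $*$ (Zhu's algebra) with unit $[|0\rangle]$,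 and $A(M)$ is an $A(V)$-bimodule with the induced left and right actions. *)

theory Defs
  imports
    Complex_Main
    "HOL-Library.Poly_Mapping"
    "HOL-Library.Groups_Big_Fun"
    "HOL-Computational_Algebra.Formal_Power_Series"
begin

section \<open>Modes\<close>

text \<open>\<open>Mode h n\<close> stands for the element \<open>h \<otimes> t\<^sup>n\<close>, \<open>h\<close> one of the two basis vectors of
  the symplectic plane. The index is rational so that the untwisted (integral) and the twisted
  (half-integral) sector can be treated together. The linear order is only used to fix a basis
  of the Fock spaces.\<close>

datatype fermion = E | F

datatype mode = Mode (kind: fermion) (index: rat)

instantiation mode :: linorder
begin

definition less_mode :: "mode \<Rightarrow> mode \<Rightarrow> bool" where
  "x < y \<longleftrightarrow> kind x = E \<and> kind y = F \<or> kind x = kind y \<and> index x < index y"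

definition less_eq_mode :: "mode \<Rightarrow> mode \<Rightarrow> bool" where
  "x \<le> y \<longleftrightarrow> x = y \<or> x < (y :: mode)"

instance
proof
  fix x y z :: mode
  show "x < y \<longleftrightarrow> x \<le> y \<and> \<not> y \<le> x"
    by (auto simp: less_eq_mode_def less_mode_def)
  show "x \<le> x"
    by (simp add: less_eq_mode_def)
  show "x \<le> y \<Longrightarrow> y \<le> z \<Longrightarrow> x \<le> z"
    by (auto simp: less_eq_mode_def less_mode_def)
  show "x \<le> y \<Longrightarrow> y \<le> x \<Longrightarrow> x = y"
    by (auto simp: less_eq_mode_def less_mode_def)
  show "x \<le> y \<or> y \<le> x"
    by (cases x; cases y; cases "kind x"; cases "kind y") (auto simp: less_eq_mode_def less_mode_def)
qed

end

fun form :: "fermion \<Rightarrow> fermion \<Rightarrow> rat" where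
  "form E F = -1"
| "form F E = 1"
| "form _ _ = 0"

text \<open>The bracket \<open>[x, y]\<^sub>+\<close> at level \<open>K = 1\<close>.\<close>

definition bracket :: "mode \<Rightarrow> mode \<Rightarrow> complex" where
  "bracket x y = (if index x + index y = 0 then of_rat (index x * form (kind x) (kind y)) else 0)"

definition int_modes :: "rat set" where
  "int_modes = \<int>"

definition half_modes :: "rat set" where
  "half_modes = {n. n - 1/2 \<in> \<int>}"


section \<open>Fock spaces\<close>

text \<open>The basis vector \<open>ket A\<close>, for a finite set \<open>A = {x\<^sub>1 < \<dots> < x\<^sub>r}\<close> of modes of
  negative index, is \<open>x\<^sub>1 \<cdots> x\<^sub>r vac\<close> (lemma \<open>ket_eq_word_vec\<close>). The two induced
  modules are the subspaces spanned by such vectors with modes in \<open>int_modes\<close> and in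
  \<open>half_modes\<close>; they share the expression \<open>vac\<close> for their generators.
  Lemmas \<open>act_anticommute\<close>, \<open>act_vac\<close>, \<open>act_fock_space\<close> and \<open>fock_space_induced\<close>
  identify them as the modules induced from the trivial module of the nonnegative modes with \<open>K = 1\<close>.\<close>

type_synonym fock = "mode set \<Rightarrow>\<^sub>0 complex"

definition scale :: "complex \<Rightarrow> fock \<Rightarrow> fock" where
  "scale c v = Poly_Mapping.map ((*) c) v"

lemma lookup_scale [simp]: "Poly_Mapping.lookup (scale c v) A = c * Poly_Mapping.lookup v A"
  by (auto simp: scale_def Poly_Mapping.map.rep_eq when_def)

global_interpretation fock: vector_space scale
  by standard (auto intro!: poly_mapping_eqI simp: lookup_add algebra_simps)

definition ket :: "mode set \<Rightarrow> fock" where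
  "ket A = Poly_Mapping.single A 1"

abbreviation vac :: fock where
  "vac \<equiv> ket {}"

text \<open>\<open>lin g\<close> is the linear map sending \<open>ket A\<close> to \<open>g A\<close>.\<close>

definition lin :: "(mode set \<Rightarrow> fock) \<Rightarrow> fock \<Rightarrow> fock" where
  "lin g v = (\<Sum>A\<in>Poly_Mapping.keys v. scale (Poly_Mapping.lookup v A) (g A))"

definition sgn_before :: "mode \<Rightarrow> mode set \<Rightarrow> complex" where
  "sgn_before x A = (-1) ^ card {y \<in> A. y < x}"

definition create :: "mode \<Rightarrow> mode set \<Rightarrow> fock" where
  "create x A = (if x \<in> A then 0 else scale (sgn_before x A) (ket (insert x A)))"

definition contract :: "mode \<Rightarrow> mode set \<Rightarrow> fock" where
  "contract x A = (if x \<in> A then scale (sgn_before x A) (ket (A - {x})) else 0)"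

text \<open>The action \<open>h\<^bsub>(n)\<^esub>\<close> of the mode \<open>x = h \<otimes> t\<^sup>n\<close>.\<close>

definition act :: "mode \<Rightarrow> fock \<Rightarrow> fock" where
  "act x v =
     (if index x < 0 then lin (create x) v
      else (\<Sum>k\<in>{E, F}. scale (bracket x (Mode k (- index x))) (lin (contract (Mode k (- index x))) v)))"

definition word_vec :: "mode list \<Rightarrow> fock" where
  "word_vec w = foldr act w vac"

definition creation_modes :: "rat set \<Rightarrow> mode set" where
  "creation_modes S = {x. index x \<in> S \<and> index x < 0}"

definition fock_space :: "rat set \<Rightarrow> fock set" where
  "fock_space S = fock.span {word_vec w | w. set w \<subseteq> creation_modes S}"

definition fock_even :: "rat set \<Rightarrow> fock set" where
  "fock_even S = fock.span {word_vec w | w. set w \<subseteq> creation_modes S \<and> even (length w)}"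

definition fock_odd :: "rat set \<Rightarrow> fock set" where
  "fock_odd S = fock.span {word_vec w | w. set w \<subseteq> creation_modes S \<and> odd (length w)}"

definition T_plus :: "fock set" where "T_plus = fock_even int_modes"
definition Tt_plus :: "fock set" where "Tt_plus = fock_even half_modes"
definition Tt_minus :: "fock set" where "Tt_minus = fock_odd half_modes"


subsection \<open>Identification with the induced modules\<close>

lemma lin_superset:
  "finite B \<Longrightarrow> Poly_Mapping.keys v \<subseteq> B \<Longrightarrow> lin g v = (\<Sum>A\<in>B. scale (Poly_Mapping.lookup v A) (g A))"
  unfolding lin_def by (rule sum.mono_neutral_left) (auto simp: in_keys_iff)

lemma lin_add: "lin g (u + v) = lin g u + lin g v"
proof -
  let ?B = "Poly_Mapping.keys u \<union> Poly_Mapping.keys v"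
  have "Poly_Mapping.keys (u + v) \<subseteq> ?B" by (rule keys_add)
  then show ?thesis
    by (simp add: lin_superset[of ?B] lookup_add fock.scale_left_distrib sum.distrib)
qed

lemma lin_scale: "lin g (scale c v) = scale c (lin g v)"
proof -
  have "Poly_Mapping.keys (scale c v) \<subseteq> Poly_Mapping.keys v" by (auto simp: in_keys_iff)
  then show ?thesis
    by (simp add: lin_superset[of "Poly_Mapping.keys v"] fock.scale_sum_right)
qed

lemma lin_ket [simp]: "lin g (ket A) = g A"
  by (simp add: lin_def ket_def)

lemma lin_zero [simp]: "lin g 0 = 0"
  by (simp add: lin_def)

lemma lin_minus: "lin g (- v) = - lin g v"
  using lin_scale[of g "-1" v] by simp

lemma act_add: "act x (u + v) = act x u + act x v"
  by (simp add: act_def lin_add fock.scale_right_distrib)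

lemma act_scale: "act x (scale c v) = scale c (act x v)"
  by (simp add: act_def lin_scale fock.scale_right_distrib mult.commute)

lemma act_zero [simp]: "act x 0 = 0"
  using act_scale[of x 0 0] by simp

lemma act_minus: "act x (- v) = - act x v"
  by (metis act_add act_zero add.right_inverse add_eq_0_iff)

definition finite_kets :: "fock set" where
  "finite_kets = fock.span {ket A | A. finite A}"

lemma create_create:
  assumes "finite A" "x < y"
  shows "lin (create x) (create y A) + lin (create y) (create x A) = 0"
proof (cases "x \<in> A \<or> y \<in> A")
  case True
  then show ?thesis by (auto simp: create_def lin_scale)
next
  case False
  have "{z \<in> insert y A. z < x} = {z \<in> A. z < x}" using assms by auto
  then have 1: "sgn_before x (insert y A) = sgn_before x A" by (simp add: sgn_before_def)
  have "{z \<in> insert x A. z < y} = insert x {z \<in> A. z < y}" using assms by auto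
  then have 2: "sgn_before y (insert x A) = - sgn_before y A"
    using False assms by (simp add: sgn_before_def)
  show ?thesis using False assms 1 2
    by (auto simp: create_def lin_scale insert_commute mult.commute)
qed

lemma contract_contract:
  assumes "finite A" "x < y"
  shows "lin (contract x) (contract y A) + lin (contract y) (contract x A) = 0"
proof (cases "x \<in> A \<and> y \<in> A")
  case False
  then show ?thesis using assms by (auto simp: contract_def lin_scale)
next
  case True
  have "{z \<in> A - {y}. z < x} = {z \<in> A. z < x}" using assms by auto
  then have 1: "sgn_before x (A - {y}) = sgn_before x A" by (simp add: sgn_before_def)
  have "{z \<in> A. z < y} = insert x {z \<in> A - {x}. z < y}" using assms True by auto
  then have 2: "sgn_before y A = - sgn_before y (A - {x})"
    using assms by (simp add: sgn_before_def)
  have 3: "A - {x} - {y} = A - {x, y}" "A - {y} - {x} = A - {x, y}" by auto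
  have "contract y A = scale (sgn_before y A) (ket (A - {y}))"
      "contract x A = scale (sgn_before x A) (ket (A - {x}))"
      "contract x (A - {y}) = scale (sgn_before x A) (ket (A - {x, y}))"
      "contract y (A - {x}) = scale (sgn_before y (A - {x})) (ket (A - {x, y}))"
    using True assms by (auto simp: contract_def 1 3)
  then show ?thesis by (simp add: lin_scale lin_minus 2 mult.commute)
qed

lemma sgn_before_sq [simp]: "sgn_before x A * sgn_before x A = 1"
  unfolding sgn_before_def by (simp flip: power_add mult_2)

lemma create_contract_same:
  assumes "finite A"
  shows "lin (create x) (contract x A) + lin (contract x) (create x A) = ket A"
proof -
  have "{z \<in> insert x A. z < x} = {z \<in> A. z < x}" "{z \<in> A - {x}. z < x} = {z \<in> A. z < x}" by auto
  then have "sgn_before x (insert x A) = sgn_before x A" "sgn_before x (A - {x}) = sgn_before x A"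
    by (simp_all add: sgn_before_def)
  then show ?thesis using assms
    by (auto simp: create_def contract_def lin_scale insert_absorb)
qed

lemma create_contract:
  assumes "finite A" "x \<noteq> y"
  shows "lin (create x) (contract y A) + lin (contract y) (create x A) = 0"
proof (cases "y \<in> A \<and> x \<notin> A")
  case False
  then show ?thesis using assms by (auto simp: create_def contract_def lin_scale)
next
  case True
  have A: "insert x A - {y} = insert x (A - {y})" using assms by auto
  consider "x < y" | "y < x" using assms by fastforce
  then have "sgn_before x (A - {y}) * sgn_before y A + sgn_before x A * sgn_before y (insert x A) = 0"
  proof cases
    case 1
    have "{z \<in> insert x A. z < y} = insert x {z \<in> A. z < y}" using 1 by auto
    moreover have "{z \<in> A - {y}. z < x} = {z \<in> A. z < x}" using 1 by auto
    ultimately show ?thesis using assms True by (simp add: sgn_before_def)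
  next
    case 2
    have "{z \<in> insert x A. z < y} = {z \<in> A. z < y}" using 2 by auto
    moreover have "{z \<in> A. z < x} = insert y {z \<in> A - {y}. z < x}" using 2 True by auto
    ultimately show ?thesis using assms by (simp add: sgn_before_def)
  qed
  then show ?thesis using True assms A
    by (auto simp: create_def contract_def lin_scale mult.commute simp flip: fock.scale_left_distrib)
qed

lemma create_create_any:
  assumes "finite A"
  shows "lin (create x) (create y A) + lin (create y) (create x A) = 0"
proof (cases x y rule: linorder_cases)
  case equal then show ?thesis by (auto simp: create_def lin_scale)
next
  case greater then show ?thesis using create_create[OF assms, of y x] by (simp only: add.commute)
qed (use create_create[OF assms] in auto)

lemma contract_contract_any:
  assumes "finite A"
  shows "lin (contract x) (contract y A) + lin (contract y) (contract x A) = 0"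
proof (cases x y rule: linorder_cases)
  case equal then show ?thesis by (auto simp: contract_def lin_scale)
next
  case greater then show ?thesis using contract_contract[OF assms, of y x] by (simp only: add.commute)
qed (use contract_contract[OF assms] in auto)

lemma bracket_commute: "bracket x y = bracket y x"
proof (cases "index x + index y = 0")
  case True
  then have "index y = - index x" by simp
  then show ?thesis
    by (cases "kind x"; cases "kind y") (simp_all add: bracket_def)
qed (simp add: bracket_def add.commute)

lemma act_ket_anticommute:
  assumes "finite A"
  shows "act x (act y (ket A)) + act y (act x (ket A)) = scale (bracket x y) (ket A)"
proof -
  have *: "act x (act y (ket A)) + act y (act x (ket A)) = scale (bracket x y) (ket A)"
    if "index x < 0" "\<not> index y < 0" for x y
  proof -
    let ?m = "\<lambda>k. Mode k (- index y)"
    have "act x (act y (ket A)) + act y (act x (ket A))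
       = (\<Sum>k\<in>{E,F}. scale (bracket y (?m k))
           (lin (create x) (contract (?m k) A) + lin (contract (?m k)) (create x A)))"
      using that by (simp add: act_def lin_add lin_scale fock.scale_right_distrib)
    also have "\<dots> = (\<Sum>k\<in>{E,F}. if x = ?m k then scale (bracket y (?m k)) (ket A) else 0)"
      using create_contract_same[OF assms] create_contract[OF assms] by (intro sum.cong) auto
    also have "\<dots> = scale (bracket y x) (ket A)"
    proof (cases "index x = - index y")
      case True
      then show ?thesis by (cases x; cases "kind x") auto
    next
      case False
      then have "bracket y x = 0" by (auto simp: bracket_def)
      moreover have "x \<noteq> ?m k" for k using False by auto
      ultimately show ?thesis by simp
    qed
    finally show ?thesis by (simp add: bracket_commute)
  qed
  consider "index x < 0" "index y < 0" | "index x < 0" "\<not> index y < 0"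
    | "\<not> index x < 0" "index y < 0" | "\<not> index x < 0" "\<not> index y < 0" by blast
  then show ?thesis
  proof cases
    case 1
    then have "bracket x y = 0" by (simp add: bracket_def)
    with 1 create_create_any[OF assms] show ?thesis by (simp add: act_def)
  next
    case 2 then show ?thesis by (rule *)
  next
    case 3 then show ?thesis using *[of y x] by (simp add: add.commute bracket_commute)
  next
    case 4
    have "bracket x y = 0"
    proof (cases "index x + index y = 0")
      case True with 4 have "index x = 0" by simp
      then show ?thesis by (simp add: bracket_def)
    qed (simp add: bracket_def)
    moreover have "act x (act y (ket A)) + act y (act x (ket A))
       = (\<Sum>j\<in>{E,F}. \<Sum>k\<in>{E,F}. scale (bracket x (Mode j (- index x)) * bracket y (Mode k (- index y)))
           (lin (contract (Mode j (- index x))) (contract (Mode k (- index y)) A)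
            + lin (contract (Mode k (- index y))) (contract (Mode j (- index x)) A)))"
      using 4 by (simp add: act_def lin_add lin_scale fock.scale_right_distrib mult.commute)
    ultimately show ?thesis by (simp add: contract_contract_any[OF assms])
  qed
qed

lemma act_finite_kets: assumes "v \<in> finite_kets" shows "act x v \<in> finite_kets"
proof -
  have k: "ket A \<in> finite_kets" if "finite A" for A using that unfolding finite_kets_def by (auto intro: fock.span_base)
  have s: "scale c v \<in> finite_kets" if "v \<in> finite_kets" for c v using that unfolding finite_kets_def by (rule fock.span_scale)
  have a: "u + v \<in> finite_kets" if "u \<in> finite_kets" "v \<in> finite_kets" for u v using that unfolding finite_kets_def by (rule fock.span_add)
  have z: "0 \<in> finite_kets" unfolding finite_kets_def by (rule fock.span_zero)
  show ?thesis using assms unfolding finite_kets_def[of]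
  proof (induction rule: fock.span_induct_alt)
    case base show ?case using z unfolding finite_kets_def by simp
  next
    case (step c u v)
    then obtain A where A: "u = ket A" "finite A" by blast
    have "act x u \<in> finite_kets"
      using A by (auto simp: act_def create_def contract_def intro!: a s k z)
    then show ?case using step a s unfolding finite_kets_def by (simp add: act_add act_scale)
  qed
qed

lemma act_anticommute_finite_kets:
  assumes "v \<in> finite_kets"
  shows "act x (act y v) + act y (act x v) = scale (bracket x y) v"
  using assms unfolding finite_kets_def
proof (induction rule: fock.span_induct_alt)
  case base show ?case by simp
next
  case (step c u v)
  then obtain A where A: "u = ket A" "finite A" by blast
  have "act x (act y (scale c u + v)) + act y (act x (scale c u + v))
     = scale c (act x (act y u) + act y (act x u)) + (act x (act y v) + act y (act x v))"
    by (simp add: act_add act_scale fock.scale_right_distrib algebra_simps)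
  then show ?case using step A act_ket_anticommute by (simp add: fock.scale_right_distrib mult.commute)
qed

lemma act_vac: "index x \<ge> 0 \<Longrightarrow> act x vac = 0"
  by (simp add: act_def contract_def)

lemma vac_finite_kets: "vac \<in> finite_kets"
  unfolding finite_kets_def by (auto intro: fock.span_base)

lemma word_vec_Cons: "word_vec (x # w) = act x (word_vec w)"
  by (simp add: word_vec_def)

lemma word_vec_finite_kets: "word_vec w \<in> finite_kets"
  by (induction w) (simp_all add: word_vec_def vac_finite_kets act_finite_kets)

lemma fock_space_finite_kets: "fock_space S \<subseteq> finite_kets"
  unfolding fock_space_def
  by (rule fock.span_minimal) (auto simp: word_vec_finite_kets, simp add: finite_kets_def)

lemma act_anticommute:
  assumes "v \<in> fock_space S"
  shows "act x (act y v) + act y (act x v) = scale (bracket x y) v"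
  using assms fock_space_finite_kets act_anticommute_finite_kets by blast

lemma word_vec_sorted:
  "sorted w \<Longrightarrow> distinct w \<Longrightarrow> \<forall>x\<in>set w. index x < 0 \<Longrightarrow> word_vec w = ket (set w)"
proof (induction w)
  case Nil show ?case by (simp add: word_vec_def)
next
  case (Cons x w)
  then have IH: "word_vec w = ket (set w)" by simp
  have "{y \<in> set w. y < x} = {}" using Cons by (auto simp: leD)
  then have "sgn_before x (set w) = 1" by (simp only: sgn_before_def card.empty power_0)
  then show ?case using Cons IH by (simp add: word_vec_Cons act_def create_def)
qed

lemma ket_eq_word_vec:
  assumes "finite A" "A \<subseteq> creation_modes S"
  shows "ket A = word_vec (sorted_list_of_set A)"
proof -
  have "\<forall>x\<in>set (sorted_list_of_set A). index x < 0" using assms by (auto simp: creation_modes_def)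
  then show ?thesis using word_vec_sorted[of "sorted_list_of_set A"] assms(1) by simp
qed

text \<open>Alternating functions on words are determined by their values on increasing words.\<close>

definition alternating :: "mode set \<Rightarrow> (mode list \<Rightarrow> 'b::ab_group_add) \<Rightarrow> bool" where
  "alternating C L \<longleftrightarrow> (\<forall>us x y vs. set (us @ x # y # vs) \<subseteq> C \<longrightarrow> L (us @ x # y # vs) = - L (us @ y # x # vs))"

lemma alternatingD: "alternating C L \<Longrightarrow> set (us @ x # y # vs) \<subseteq> C \<Longrightarrow> L (us @ x # y # vs) = - L (us @ y # x # vs)"
  unfolding alternating_def by blast

lemma alternating_Cons: "alternating C L \<Longrightarrow> x \<in> C \<Longrightarrow> alternating C (\<lambda>w. L (x # w))"
  unfolding alternating_def[of C "\<lambda>w. L (x # w)"]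
proof (intro allI impI)
  fix us a b vs
  assume "alternating C L" "x \<in> C" "set (us @ a # b # vs) \<subseteq> C"
  then show "L (x # us @ a # b # vs) = - L (x # us @ b # a # vs)"
    using alternatingD[of C L "x # us" a b vs] by (simp only: append_Cons) simp
qed

lemma alternating_insort:
  "alternating C L \<Longrightarrow> set (x # w) \<subseteq> C \<Longrightarrow> L (x # w) = L (insort x w) \<or> L (x # w) = - L (insort x w)"
proof (induction w arbitrary: L)
  case (Cons y w)
  have "L (x # y # w) = - L (y # x # w)" using alternatingD[OF Cons.prems(1), of "[]" x y w] Cons.prems(2) by simp
  moreover have "L (y # x # w) = L (y # insort x w) \<or> L (y # x # w) = - L (y # insort x w)"
    using Cons.IH[OF alternating_Cons[OF Cons.prems(1), of y]] Cons.prems(2) by simp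
  ultimately show ?case by auto
qed simp

lemma alternating_sort:
  "alternating C L \<Longrightarrow> set w \<subseteq> C \<Longrightarrow> L w = L (sort w) \<or> L w = - L (sort w)"
proof (induction w arbitrary: L)
  case (Cons x w)
  have "L (x # w) = L (x # sort w) \<or> L (x # w) = - L (x # sort w)"
    using Cons.IH[OF alternating_Cons[OF Cons.prems(1), of x]] Cons.prems(2) by simp
  moreover have "L (x # sort w) = L (insort x (sort w)) \<or> L (x # sort w) = - L (insort x (sort w))"
    using alternating_insort[OF Cons.prems(1), of x "sort w"] Cons.prems(2) by simp
  ultimately show ?case by auto
qed simp

lemma sorted_not_distinct:
  fixes w :: "'a::linorder list"
  shows "sorted w \<Longrightarrow> \<not> distinct w \<Longrightarrow> \<exists>us x vs. w = us @ x # x # vs"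
proof (induction w)
  case (Cons x w)
  show ?case
  proof (cases "distinct w")
    case False
    then obtain us y vs where "w = us @ y # y # vs" using Cons by auto
    then have "x # w = (x # us) @ y # y # vs" by simp
    then show ?thesis by blast
  next
    case True
    then have "x \<in> set w" using Cons by simp
    then obtain y v where w: "w = y # v" by (cases w) auto
    then have "x = y" using Cons.prems(1) \<open>x \<in> set w\<close> by auto
    then have "x # w = [] @ x # x # v" using w by simp
    then show ?thesis by blast
  qed
qed simp

lemma alternating_zero:
  fixes L :: "mode list \<Rightarrow> 'b::ab_group_add"
  assumes L: "alternating C L" and torsion: "\<And>a::'b. a + a = 0 \<Longrightarrow> a = 0"
    and sorted: "\<And>w. sorted w \<Longrightarrow> distinct w \<Longrightarrow> set w \<subseteq> C \<Longrightarrow> L w = 0"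
    and w: "set w \<subseteq> C"
  shows "L w = 0"
proof -
  have "L (sort w) = 0"
  proof (cases "distinct w")
    case True
    then show ?thesis using sorted[of "sort w"] w by simp
  next
    case False
    then obtain us x vs where *: "sort w = us @ x # x # vs"
      using sorted_not_distinct[of "sort w"] by auto
    have "set (sort w) \<subseteq> C" using w by simp
    then have "L (us @ x # x # vs) = - L (us @ x # x # vs)"
      unfolding * by (rule alternatingD[OF L])
    then have "L (sort w) + L (sort w) = 0"
      unfolding * by (simp only: eq_neg_iff_add_eq_0)
    then show ?thesis by (rule torsion)
  qed
  then show ?thesis using alternating_sort[OF L w] by auto
qed

lemma fock_torsion: "a + a = 0 \<Longrightarrow> a = 0" for a :: fock
proof (intro poly_mapping_eqI)
  fix k
  assume "a + a = 0"
  then have "Poly_Mapping.lookup (a + a) k = 0" by simp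
  then show "Poly_Mapping.lookup a k = Poly_Mapping.lookup 0 k" by (simp add: lookup_add)
qed

lemma word_vec_alternating: "alternating {x. index x < 0} word_vec"
  unfolding alternating_def
proof (intro allI impI)
  fix us x y vs assume *: "set (us @ x # y # vs) \<subseteq> {x. index x < 0}"
  have "act x (act y (word_vec vs)) + act y (act x (word_vec vs)) = scale (bracket x y) (word_vec vs)"
    by (rule act_anticommute_finite_kets[OF word_vec_finite_kets])
  moreover have "bracket x y = 0" using * by (auto simp: bracket_def)
  ultimately have "act x (act y (word_vec vs)) = - act y (act x (word_vec vs))"
    by (simp add: eq_neg_iff_add_eq_0)
  then show "word_vec (us @ x # y # vs) = - word_vec (us @ y # x # vs)"
    by (induction us) (simp_all add: word_vec_Cons act_minus)
qed


lemma act_fock_space_word: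
  assumes "index x \<in> S" "set w \<subseteq> creation_modes S"
  shows "act x (word_vec w) \<in> fock_space S"
proof (cases "index x < 0")
  case True
  then have "set (x # w) \<subseteq> creation_modes S" using assms by (simp add: creation_modes_def)
  then have "word_vec (x # w) \<in> fock_space S"
    unfolding fock_space_def by (intro fock.span_base) blast
  then show ?thesis by (simp add: word_vec_Cons)
next
  case False
  have gen: "word_vec w \<in> fock_space S" if "set w \<subseteq> creation_modes S" for w
    unfolding fock_space_def using that by (intro fock.span_base) blast
  have cr: "act y v \<in> fock_space S" if y: "y \<in> creation_modes S" and v: "v \<in> fock_space S" for y v
    using v unfolding fock_space_def
  proof (induction rule: fock.span_induct_alt)
    case base show ?case by (simp add: fock.span_zero)
  next
    case (step c u v)
    then obtain w where w: "u = word_vec w" "set w \<subseteq> creation_modes S" by blast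
    have "act y u \<in> fock_space S" using gen[of "y # w"] w y by (simp add: word_vec_Cons)
    then show ?case using step unfolding fock_space_def
      by (simp add: act_add act_scale fock.span_add fock.span_scale)
  qed
  show ?thesis using assms(2)
  proof (induction w)
    case Nil
    show ?case using False by (simp add: word_vec_def act_vac fock_space_def fock.span_zero)
  next
    case (Cons y w)
    have "act x (act y (word_vec w)) = scale (bracket x y) (word_vec w) - act y (act x (word_vec w))"
      using act_anticommute_finite_kets[OF word_vec_finite_kets, of x y w] by (simp add: algebra_simps)
    also have "\<dots> \<in> fock_space S"
      using Cons cr gen[of w] unfolding fock_space_def
      by (intro fock.span_diff fock.span_scale) auto
    finally show ?case by (simp add: word_vec_Cons)
  qed
qed

lemma act_fock_space:
  assumes "index x \<in> S" "v \<in> fock_space S"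
  shows "act x v \<in> fock_space S"
  using assms(2) unfolding fock_space_def
proof (induction rule: fock.span_induct_alt)
  case base show ?case by (simp add: fock.span_zero)
next
  case (step c u v)
  then obtain w where w: "u = word_vec w" "set w \<subseteq> creation_modes S" by blast
  then have "act x u \<in> fock_space S" using act_fock_space_word[OF assms(1)] by simp
  then show ?case using step unfolding fock_space_def
    by (simp add: act_add act_scale fock.span_add fock.span_scale)
qed

text \<open>The universal property of the induced module; uniqueness of \<open>\<phi>\<close> on \<open>fock_space S\<close> is clear,
  as this space is spanned by the vectors \<open>word_vec w\<close>.\<close>

theorem fock_space_induced:
  fixes s :: "complex \<Rightarrow> 'b \<Rightarrow> 'b::ab_group_add" and \<rho> :: "mode \<Rightarrow> 'b \<Rightarrow> 'b" and w0 :: 'b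
  assumes "vector_space s"
    and rho_linear: "\<And>x. index x \<in> S \<Longrightarrow> Vector_Spaces.linear s s (\<rho> x)"
    and rho_anticommute: "\<And>x y w. index x \<in> S \<Longrightarrow> index y \<in> S \<Longrightarrow>
          \<rho> x (\<rho> y w) + \<rho> y (\<rho> x w) = s (bracket x y) w"
    and rho_w0: "\<And>x. index x \<in> S \<Longrightarrow> index x \<ge> 0 \<Longrightarrow> \<rho> x w0 = 0"
  shows "\<exists>\<phi>. Vector_Spaces.linear scale s \<phi> \<and> \<phi> vac = w0 \<and>
           (\<forall>x v. index x \<in> S \<longrightarrow> v \<in> fock_space S \<longrightarrow> \<phi> (act x v) = \<rho> x (\<phi> v))"
proof -
  interpret W: vector_space s by fact
  let ?L = "\<lambda>w. foldr \<rho> w w0"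
  define \<phi> where "\<phi> v = (\<Sum>A\<in>Poly_Mapping.keys v. s (Poly_Mapping.lookup v A) (?L (sorted_list_of_set A)))" for v
  have sup: "\<phi> v = (\<Sum>A\<in>B. s (Poly_Mapping.lookup v A) (?L (sorted_list_of_set A)))"
    if "finite B" "Poly_Mapping.keys v \<subseteq> B" for B v
    unfolding \<phi>_def using that by (intro sum.mono_neutral_left) (auto simp: in_keys_iff)
  have add: "\<phi> (u + v) = \<phi> u + \<phi> v" for u v
  proof -
    let ?B = "Poly_Mapping.keys u \<union> Poly_Mapping.keys v"
    have "Poly_Mapping.keys (u + v) \<subseteq> ?B" by (rule keys_add)
    then show ?thesis by (simp add: sup[of ?B] lookup_add W.scale_left_distrib sum.distrib)
  qed
  have scl: "\<phi> (scale c v) = s c (\<phi> v)" for c v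
  proof -
    have "Poly_Mapping.keys (scale c v) \<subseteq> Poly_Mapping.keys v" by (auto simp: in_keys_iff)
    then show ?thesis by (simp add: sup[of "Poly_Mapping.keys v"] W.scale_sum_right)
  qed
  have \<phi>_lin: "Vector_Spaces.linear scale s \<phi>"
    by (simp add: Vector_Spaces.linear_iff fock.vector_space_axioms W.vector_space_axioms add scl)
  have \<phi>0: "\<phi> 0 = 0" by (simp add: \<phi>_def)
  have neg: "\<phi> (- v) = - \<phi> v" for v
    using add[of v "- v"] \<phi>0 by (simp add: eq_neg_iff_add_eq_0 add.commute)
  have r_add: "\<rho> x (a + b) = \<rho> x a + \<rho> x b" and r_scl: "\<rho> x (s c a) = s c (\<rho> x a)"
    if "index x \<in> S" for x a b c
    using rho_linear[OF that] by (simp_all add: Vector_Spaces.linear_iff)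
  have r0: "\<rho> x 0 = 0" if "index x \<in> S" for x using r_scl[OF that, of 0 0] by simp
  have r_neg: "\<rho> x (- a) = - \<rho> x a" if "index x \<in> S" for x a
    using r_add[OF that, of a "- a"] r0[OF that] by (simp add: eq_neg_iff_add_eq_0 add.commute)
  have torsion: "a = 0" if "a + a = 0" for a :: 'b
  proof -
    have "s 2 a = 0" using that W.scale_left_distrib[of 1 1 a] by simp
    then show ?thesis by simp
  qed
  have alt: "alternating (creation_modes S) (\<lambda>w. \<phi> (word_vec w) - ?L w)"
    unfolding alternating_def
  proof (intro allI impI)
    fix us x y vs assume *: "set (us @ x # y # vs) \<subseteq> creation_modes S"
    have "word_vec (us @ x # y # vs) = - word_vec (us @ y # x # vs)"
      using * by (intro alternatingD[OF word_vec_alternating]) (auto simp: creation_modes_def)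
    moreover have "?L (us @ x # y # vs) = - ?L (us @ y # x # vs)"
      using *
    proof (induction us)
      case Nil
      then have "bracket x y = 0" "index x \<in> S" "index y \<in> S" by (auto simp: bracket_def creation_modes_def)
      then show ?case using rho_anticommute[of x y "?L vs"] by (simp add: eq_neg_iff_add_eq_0)
    next
      case (Cons a us)
      then show ?case by (simp add: r_neg creation_modes_def)
    qed
    ultimately show "\<phi> (word_vec (us @ x # y # vs)) - ?L (us @ x # y # vs) =
        - (\<phi> (word_vec (us @ y # x # vs)) - ?L (us @ y # x # vs))"
      by (simp add: neg)
  qed
  have word: "\<phi> (word_vec w) = ?L w" if "set w \<subseteq> creation_modes S" for w
  proof -
    have "\<phi> (word_vec w) - ?L w = 0"
    proof (rule alternating_zero[OF alt torsion _ that])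
      fix w assume w: "sorted w" "distinct w" "set w \<subseteq> creation_modes S"
      then have "word_vec w = ket (set w)"
        by (intro word_vec_sorted) (auto simp: creation_modes_def)
      moreover have "sorted_list_of_set (set w) = w"
        using w by (simp add: sorted_list_of_set.idem_if_sorted_distinct)
      ultimately show "\<phi> (word_vec w) - ?L w = 0" by (simp add: \<phi>_def ket_def)
    qed
    then show ?thesis by simp
  qed
  have ext: "\<phi> (act x v) = \<rho> x (\<phi> v)"
    if x: "index x \<in> S" and w: "\<And>w. set w \<subseteq> creation_modes S \<Longrightarrow> \<phi> (act x (word_vec w)) = \<rho> x (\<phi> (word_vec w))"
      and v: "v \<in> fock_space S" for x v
    using v unfolding fock_space_def
  proof (induction rule: fock.span_induct_alt)
    case base show ?case by (simp add: \<phi>0 r0 x)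
  next
    case (step c u v)
    then show ?case using w by (auto simp: act_add act_scale add scl r_add r_scl x)
  qed
  have cr: "\<phi> (act x v) = \<rho> x (\<phi> v)" if x: "x \<in> creation_modes S" and v: "v \<in> fock_space S" for x v
  proof (rule ext[OF _ _ v])
    show "index x \<in> S" using x by (simp add: creation_modes_def)
    fix w assume "set w \<subseteq> creation_modes S"
    then show "\<phi> (act x (word_vec w)) = \<rho> x (\<phi> (word_vec w))"
      using word[of w] word[of "x # w"] x by (simp add: word_vec_Cons)
  qed
  have "\<phi> (act x v) = \<rho> x (\<phi> v)" if x: "index x \<in> S" and v: "v \<in> fock_space S" for x v
  proof (cases "index x < 0")
    case True
    then show ?thesis using cr x v by (simp add: creation_modes_def)
  next
    case False
    show ?thesis
    proof (rule ext[OF x _ v])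
      fix w assume "set w \<subseteq> creation_modes S"
      then show "\<phi> (act x (word_vec w)) = \<rho> x (\<phi> (word_vec w))"
      proof (induction w)
        case Nil
        then show ?case using False x word[of "[]"] rho_w0 by (simp add: word_vec_def act_vac \<phi>0)
      next
        case (Cons y w)
        then have y: "y \<in> creation_modes S" "index y \<in> S" by (auto simp: creation_modes_def)
        have "act x (act y (word_vec w)) = scale (bracket x y) (word_vec w) + - act y (act x (word_vec w))"
          using act_anticommute_finite_kets[OF word_vec_finite_kets, of x y w] by (simp add: algebra_simps)
        then have "\<phi> (act x (act y (word_vec w))) = s (bracket x y) (\<phi> (word_vec w)) - \<phi> (act y (act x (word_vec w)))"
          by (simp only: add scl neg) simp
        also have "\<dots> = s (bracket x y) (\<phi> (word_vec w)) - \<rho> y (\<rho> x (\<phi> (word_vec w)))"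
          using Cons cr[OF y(1) act_fock_space_word[OF x]] by simp
        also have "\<dots> = \<rho> x (\<rho> y (\<phi> (word_vec w)))"
          using rho_anticommute[OF x y(2), of "\<phi> (word_vec w)"] by (simp add: algebra_simps)
        also have "\<rho> y (\<phi> (word_vec w)) = \<phi> (act y (word_vec w))"
          using word[of w] word[of "y # w"] Cons.prems by (simp add: word_vec_Cons)
        finally show ?case by (simp add: word_vec_Cons)
      qed
    qed
  qed
  moreover have "\<phi> vac = w0" using word[of "[]"] by (simp add: word_vec_def)
  ultimately show ?thesis using \<phi>_lin by blast
qed


section \<open>Vertex operators\<close>

fun nord :: "mode list \<Rightarrow> fock \<Rightarrow> fock" where
  "nord [] u = u"
| "nord (x # xs) u =
     (if index x < 0 then act x (nord xs u) else scale ((-1) ^ length xs) (nord xs (act x u)))"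

text \<open>For \<open>w = h\<^sup>1\<^bsub>(-n\<^sub>1)\<^esub> \<cdots> h\<^sup>r\<^bsub>(-n\<^sub>r)\<^esub>\<close>, \<open>field_word S w p u\<close> is the coefficient of
  \<open>z\<^sup>p\<close> in \<open>:\<partial>\<^bsup>(n\<^sub>1-1)\<^esup>h\<^sup>1(z) \<cdots> \<partial>\<^bsup>(n\<^sub>r-1)\<^esup>h\<^sup>r(z): u\<close>, the fields being sums over the mode set \<open>S\<close>:
  the coefficient of \<open>h\<^bsub>(m)\<^esub>\<close> in \<open>\<partial>\<^bsup>(k)\<^esup>h(z)\<close> is \<open>((-m-1) choose k) z\<^bsup>-m-1-k\<^esup>\<close>.
  On a vector of the Fock space all but finitely many of the summands vanish.\<close>

definition deriv_order :: "mode \<Rightarrow> nat" where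
  "deriv_order x = nat \<lfloor>- index x\<rfloor> - 1"

definition field_word :: "rat set \<Rightarrow> mode list \<Rightarrow> rat \<Rightarrow> fock \<Rightarrow> fock" where
  "field_word S w p u = Sum_any (\<lambda>ms.
     if length ms = length w \<and> set ms \<subseteq> S
        \<and> (\<Sum>(x, m)\<leftarrow>zip w ms. - m - 1 - of_nat (deriv_order x)) = p
     then scale (of_rat (\<Prod>(x, m)\<leftarrow>zip w ms. (- m - 1) gchoose deriv_order x))
            (nord (map2 (\<lambda>x m. Mode (kind x) m) w ms) u)
     else 0)"

text \<open>Linear extension in the first argument; the formula for arbitrary creation words is
  recovered in lemma \<open>field_word_vec\<close>.\<close>

definition field_coeff :: "rat set \<Rightarrow> fock \<Rightarrow> rat \<Rightarrow> fock \<Rightarrow> fock" where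
  "field_coeff S v p u = lin (\<lambda>A. field_word S (sorted_list_of_set A) p u) v"

lemma nord_scale: "nord w (scale c u) = scale c (nord w u)"
  by (induction w arbitrary: u) (simp_all add: act_scale mult.commute)

lemma nord_minus: "nord w (- u) = - nord w u"
  using nord_scale[of w "-1" u] by simp

lemma nord_finite_kets: "u \<in> finite_kets \<Longrightarrow> nord w u \<in> finite_kets"
proof (induction w arbitrary: u)
  case (Cons x w)
  then have "nord w (act x u) \<in> finite_kets" by (simp add: act_finite_kets)
  then have "scale c (nord w (act x u)) \<in> finite_kets" for c
    unfolding finite_kets_def by (rule fock.span_scale)
  then show ?case using Cons by (simp add: act_finite_kets)
qed simp

lemma nord_swap:
  assumes "u \<in> finite_kets"
  shows "nord (us @ x # y # vs) u = - nord (us @ y # x # vs) u"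
  using assms
proof (induction us arbitrary: u)
  case Nil
  have *: "act x (act y v) = - act y (act x v)" if "bracket x y = 0" "v \<in> finite_kets" for v
    using act_anticommute_finite_kets[OF that(2), of x y] that(1) by (simp add: eq_neg_iff_add_eq_0)
  consider "index x < 0" "index y < 0" | "index x < 0" "\<not> index y < 0"
    | "\<not> index x < 0" "index y < 0" | "\<not> index x < 0" "\<not> index y < 0" by blast
  then show ?case
  proof cases
    case 1
    then have "bracket x y = 0" by (simp add: bracket_def)
    then show ?thesis using 1 * nord_finite_kets[OF Nil] by simp
  next
    case 4
    have "bracket x y = 0"
    proof (cases "index x + index y = 0")
      case True with 4 have "index x = 0" by simp
      then show ?thesis by (simp add: bracket_def)
    qed (simp add: bracket_def)
    then show ?thesis using 4 *[OF _ Nil] by (simp add: nord_minus)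
  qed (simp_all add: act_scale)
next
  case (Cons a us)
  then show ?case by (simp add: act_minus act_finite_kets)
qed

lemma Sum_any_uminus: "Sum_any (\<lambda>a. - f a :: 'b::ab_group_add) = - Sum_any f"
  by (simp add: Sum_any.expand_set sum_negf)

lemma field_word_alternating:
  assumes "u \<in> finite_kets"
  shows "alternating C (\<lambda>w. field_word S w p u)"
  unfolding alternating_def
proof (intro allI impI)
  fix us vs :: "mode list" and x y
  let ?w = "us @ x # y # vs" and ?w' = "us @ y # x # vs"
  let ?k = "length us"
  define g where "g w ms =
    (if length ms = length w \<and> set ms \<subseteq> S
        \<and> (\<Sum>(x, m)\<leftarrow>zip w ms. - m - 1 - of_nat (deriv_order x)) = p
     then scale (of_rat (\<Prod>(x, m)\<leftarrow>zip w ms. (- m - 1) gchoose deriv_order x))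
            (nord (map2 (\<lambda>x m. Mode (kind x) m) w ms) u)
     else 0)" for w ms
  define \<sigma> where "\<sigma> ms = (if length ms = length ?w then ms[?k := ms ! Suc ?k, Suc ?k := ms ! ?k] else ms)"
    for ms :: "rat list"
  have split: "\<exists>a m n b. ms = a @ m # n # b \<and> length a = ?k \<and> length b = length vs"
    if "length ms = length ?w" for ms :: "rat list"
  proof -
    have "ms = take ?k ms @ ms ! ?k # ms ! Suc ?k # drop (Suc (Suc ?k)) ms"
      using that by (simp add: Cons_nth_drop_Suc flip: id_take_nth_drop)
    then show ?thesis using that
      by (intro exI[of _ "take ?k ms"] exI[of _ "ms ! ?k"] exI[of _ "ms ! Suc ?k"]
            exI[of _ "drop (Suc (Suc ?k)) ms"]) auto
  qed
  have \<sigma>: "\<sigma> (a @ m # n # b) = a @ n # m # b" if "length a = ?k" "length b = length vs" for a m n b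
    using that by (simp add: \<sigma>_def nth_append list_update_append)
  have inv: "\<sigma> (\<sigma> ms) = ms" for ms
  proof (cases "length ms = length ?w")
    case True then show ?thesis using split[OF True] \<sigma> by auto
  qed (simp add: \<sigma>_def)
  have g: "g ?w ms = - g ?w' (\<sigma> ms)" for ms
  proof (cases "length ms = length ?w")
    case True
    then obtain a m n b where ms: "ms = a @ m # n # b" "length a = ?k" "length b = length vs"
      using split by blast
    show ?thesis
      using ms nord_swap[OF assms, of "map2 (\<lambda>x m. Mode (kind x) m) us a" "Mode (kind x) m" "Mode (kind y) n"
          "map2 (\<lambda>x m. Mode (kind x) m) vs b"]
      by (auto simp: g_def \<sigma> algebra_simps)
  qed (simp add: g_def \<sigma>_def)
  have "field_word S ?w p u = Sum_any (\<lambda>ms. - g ?w' (\<sigma> ms))"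
    unfolding field_word_def g[symmetric] by (simp add: g_def)
  also have "\<dots> = - Sum_any (\<lambda>ms. g ?w' (\<sigma> ms))" by (rule Sum_any_uminus)
  also have "Sum_any (\<lambda>ms. g ?w' (\<sigma> ms)) = Sum_any (g ?w')"
  proof (rule Sum_any.reindex_cong[of \<sigma>, symmetric])
    show "bij \<sigma>" using inv by (metis bijI' )
  qed (simp add: fun_eq_iff)
  also have "Sum_any (g ?w') = field_word S ?w' p u"
    unfolding field_word_def by (simp add: g_def)
  finally show "field_word S ?w p u = - field_word S ?w' p u" .
qed

lemma field_word_vec:
  assumes "u \<in> fock_space S'" "set w \<subseteq> {x. index x < 0}"
  shows "field_coeff S (word_vec w) p u = field_word S w p u"
proof -
  have u: "u \<in> finite_kets" using assms(1) fock_space_finite_kets by blast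
  have f_neg: "field_coeff S (- v) p u = - field_coeff S v p u" for v
    using lin_scale[of _ "-1" v] by (simp add: field_coeff_def)
  have alt: "alternating {x. index x < 0} (\<lambda>w. field_coeff S (word_vec w) p u - field_word S w p u)"
    unfolding alternating_def
  proof (intro allI impI)
    fix us x y vs assume *: "set (us @ x # y # vs) \<subseteq> {x. index x < 0}"
    show "field_coeff S (word_vec (us @ x # y # vs)) p u - field_word S (us @ x # y # vs) p u =
        - (field_coeff S (word_vec (us @ y # x # vs)) p u - field_word S (us @ y # x # vs) p u)"
      unfolding alternatingD[OF word_vec_alternating *]
        alternatingD[OF field_word_alternating[OF u] *] f_neg by simp
  qed
  have "field_coeff S (word_vec w) p u - field_word S w p u = 0"
  proof (rule alternating_zero[OF alt fock_torsion _ assms(2)])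
    fix w assume w: "sorted w" "distinct w" "set w \<subseteq> {x. index x < 0}"
    then have "word_vec w = ket (set w)" by (intro word_vec_sorted) auto
    moreover have "sorted_list_of_set (set w) = w"
      using w by (simp add: sorted_list_of_set.idem_if_sorted_distinct)
    ultimately show "field_coeff S (word_vec w) p u - field_word S w p u = 0"
      by (simp add: field_coeff_def)
  qed
  then show ?thesis by simp
qed

definition Y_mode :: "fock \<Rightarrow> int \<Rightarrow> fock \<Rightarrow> fock" where
  "Y_mode a n u = field_coeff int_modes a (of_int (- n - 1)) u"

text \<open>\<open>c m n\<close> is the coefficient of \<open>x\<^sup>m y\<^sup>n\<close> in \<open>- log (1 + g)\<close>, where
  \<open>g = ((1+x)\<^bsup>1/2\<^esup> + (1+y)\<^bsup>1/2\<^esup>)/2 - 1\<close> has no constant term, so that only the powers \<open>g\<^sup>k\<close>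
  with \<open>k \<le> m + n\<close> contribute. Power series in \<open>x, y\<close> are power series in \<open>y\<close> whose
  coefficients are power series in \<open>x\<close>.\<close>

definition g_series :: "complex fps fps" where
  "g_series = fps_const (fps_const (1/2)) *
     (fps_const (fps_binomial (1/2)) + Abs_fps (\<lambda>n. fps_const ((1/2) gchoose n))) - 1"

definition c_coeff :: "nat \<Rightarrow> nat \<Rightarrow> complex" where
  "c_coeff m n = - (\<Sum>k=1..m+n. (-1) ^ (k + 1) / of_nat k * fps_nth (fps_nth (g_series ^ k) n) m)"

text \<open>\<open>Delta_coeff k\<close> is the coefficient of \<open>z\<^bsup>-k\<^esup>\<close> in \<open>\<Delta>(z)\<close>. A sequence \<open>s\<close> of vectors
  stands for the series with \<open>s k\<close> as coefficient of \<open>z\<^bsup>-k\<^esup>\<close>.\<close>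

definition Delta_coeff :: "nat \<Rightarrow> fock \<Rightarrow> fock" where
  "Delta_coeff k v =
     scale 2 (\<Sum>m\<le>k. scale (c_coeff m (k - m)) (act (Mode E (of_nat m)) (act (Mode F (of_nat (k - m))) v)))"

definition Delta_series :: "(nat \<Rightarrow> fock) \<Rightarrow> nat \<Rightarrow> fock" where
  "Delta_series s k = (\<Sum>j\<le>k. Delta_coeff j (s (k - j)))"

definition exp_Delta :: "fock \<Rightarrow> nat \<Rightarrow> fock" where
  "exp_Delta v k = Sum_any (\<lambda>j.
     scale (1 / fact j) ((Delta_series ^^ j) (\<lambda>i. if i = 0 then v else 0) k))"

text \<open>The \<open>n\<close>-th mode \<open>a\<^bsub>(n)\<^esub>\<close> of \<open>Y\<^sup>\<theta>(a,z) = W(e\<^bsup>\<Delta>(z)\<^esup>a, z)\<close>.\<close>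

definition Y_theta_mode :: "fock \<Rightarrow> int \<Rightarrow> fock \<Rightarrow> fock" where
  "Y_theta_mode a n u =
     Sum_any (\<lambda>k. field_coeff half_modes (exp_Delta a k) (of_int (- n - 1 + int k)) u)"


section \<open>Zhu's algebra and Frenkel--Zhu bimodules\<close>

text \<open>The vertex operator algebra is \<open>T_plus\<close>. A module is given by its mode action
  \<open>Y a n u = a\<^bsub>(n)\<^esub>u\<close> and its carrier \<open>M\<close>. The homogeneous vector \<open>ket A\<close> has weight
  \<open>weight A\<close>, and the products are extended linearly.\<close>

definition weight :: "mode set \<Rightarrow> rat" where
  "weight A = (\<Sum>x\<in>A. - index x)"

definition circ :: "(fock \<Rightarrow> int \<Rightarrow> fock \<Rightarrow> fock) \<Rightarrow> fock \<Rightarrow> fock \<Rightarrow> fock" where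
  "circ Y a u = lin (\<lambda>A. Sum_any (\<lambda>i.
     scale (of_rat (weight A) gchoose i) (Y (ket A) (int i - 2) u))) a"

definition star_left :: "(fock \<Rightarrow> int \<Rightarrow> fock \<Rightarrow> fock) \<Rightarrow> fock \<Rightarrow> fock \<Rightarrow> fock" where
  "star_left Y a u = lin (\<lambda>A. Sum_any (\<lambda>i.
     scale (of_rat (weight A) gchoose i) (Y (ket A) (int i - 1) u))) a"

text \<open>\<open>star_right Y u a\<close> is \<open>u * a\<close>.\<close>

definition star_right :: "(fock \<Rightarrow> int \<Rightarrow> fock \<Rightarrow> fock) \<Rightarrow> fock \<Rightarrow> fock \<Rightarrow> fock" where
  "star_right Y u a = lin (\<lambda>A. Sum_any (\<lambda>i.
     scale ((of_rat (weight A) - 1) gchoose i) (Y (ket A) (int i - 1) u))) a"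

definition Zhu_O :: "(fock \<Rightarrow> int \<Rightarrow> fock \<Rightarrow> fock) \<Rightarrow> fock set \<Rightarrow> fock set" where
  "Zhu_O Y M = fock.span {circ Y a u | a u. a \<in> T_plus \<and> u \<in> M}"

definition Zhu_class :: "(fock \<Rightarrow> int \<Rightarrow> fock \<Rightarrow> fock) \<Rightarrow> fock set \<Rightarrow> fock \<Rightarrow> fock set" where
  "Zhu_class Y M u = {u + x | x. x \<in> Zhu_O Y M}"

definition Zhu_A :: "(fock \<Rightarrow> int \<Rightarrow> fock \<Rightarrow> fock) \<Rightarrow> fock set \<Rightarrow> fock set set" where
  "Zhu_A Y M = Zhu_class Y M ` M"

text \<open>Sub-bimodules of \<open>Zhu_A Y M\<close> over the algebra \<open>Zhu_A Y_mode T_plus\<close>. The induced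
  operations, such as \<open>[a] \<cdot> [u] = [a * u]\<close>, are taken over all representatives of the classes;
  this makes the closure conditions independent of a choice of representatives.\<close>

definition sub_bimodule :: "(fock \<Rightarrow> int \<Rightarrow> fock \<Rightarrow> fock) \<Rightarrow> fock set \<Rightarrow> fock set set \<Rightarrow> bool" where
  "sub_bimodule Y M N \<longleftrightarrow>
     N \<subseteq> Zhu_A Y M \<and>
     Zhu_class Y M 0 \<in> N \<and>
     (\<forall>U\<in>N. \<forall>V\<in>N. \<forall>u\<in>U. \<forall>v\<in>V. Zhu_class Y M (u + v) \<in> N) \<and>
     (\<forall>c. \<forall>U\<in>N. \<forall>u\<in>U. Zhu_class Y M (scale c u) \<in> N) \<and>
     (\<forall>\<alpha>\<in>Zhu_A Y_mode T_plus. \<forall>U\<in>N. \<forall>a\<in>\<alpha>. \<forall>u\<in>U.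
        Zhu_class Y M (star_left Y a u) \<in> N \<and> Zhu_class Y M (star_right Y u a) \<in> N)"

definition bimodule_span :: "(fock \<Rightarrow> int \<Rightarrow> fock \<Rightarrow> fock) \<Rightarrow> fock set \<Rightarrow> fock set set \<Rightarrow> fock set set" where
  "bimodule_span Y M G = \<Inter> {N. sub_bimodule Y M N \<and> G \<subseteq> N}"

end

theory Submission
  imports Defs "HOL-Computational_Algebra.Polynomial"
begin

text \<open>Order the basis vectors of the twisted Fock space by weight, then by length, and let \<open>P\<close> be a
  subspace stable under both actions. For \<open>a = h\<^bsub>(-i-1)\<^esub>k\<^bsub>(-j-1)\<^esub>|0\<rangle>\<close> the correction by \<open>e\<^bsup>\<Delta>(z)\<^esup>\<close> only adds
  multiples of \<open>u\<close> to \<open>a * u\<close> and \<open>u * a\<close>. Up to such multiples and vectors of smaller weight, \<open>a * u\<close> with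
  \<open>i + j = N - 2\<close> is the sum of the \<open>(x choose i) (N-2-x choose j) :h\<^bsub>(m)\<^esub>k\<^bsub>(-N-m)\<^esub>: u\<close>, \<open>x = -m-1\<close>, and
  \<open>a * u - u * a\<close> with \<open>i = N - 1\<close>, \<open>j = 0\<close> is the sum with coefficients \<open>x choose N - 1\<close>. These coefficients
  span all polynomials in \<open>x\<close> of degree less than \<open>N\<close>, so that by interpolation at the \<open>N\<close> pairs of creating
  modes each \<open>h\<^bsub>(m)\<^esub>k\<^bsub>(-N-m)\<^esub> u\<close> lies in \<open>P\<close> up to smaller vectors.\<close>

section \<open>Graded pieces of the Fock spaces\<close>

text \<open>The support condition describes the span of the \<open>ket A\<close> with
  \<open>A \<in> X\<close>. In this form membership is read off the coordinates;
  \<open>ket_space_subset\<close> restores the minimality of the span.\<close>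

definition ket_space :: "mode set set \<Rightarrow> fock set" where
  "ket_space X = {v. Poly_Mapping.keys v \<subseteq> X}"

text \<open>Basis labels for \<open>fock_even S\<close> when \<open>b\<close> is true and for
  \<open>fock_odd S\<close> when it is false. With the parity as a parameter, both twisted modules
  are treated at once.\<close>

definition sector :: "rat set \<Rightarrow> bool \<Rightarrow> mode set set" where
  "sector S b = {A. finite A \<and> A \<subseteq> creation_modes S \<and> even (card A) = b}"

lemma subspace_ket_space: "fock.subspace (ket_space X)"
  unfolding fock.subspace_def ket_space_def
proof (intro conjI ballI allI)
  fix u v :: fock
  assume "u \<in> {v. Poly_Mapping.keys v \<subseteq> X}" "v \<in> {v. Poly_Mapping.keys v \<subseteq> X}"
  then show "u + v \<in> {v. Poly_Mapping.keys v \<subseteq> X}" using keys_add[of u v] by blast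
qed (auto simp: in_keys_iff)

lemma ket_in_ket_space [simp]: "ket A \<in> ket_space X \<longleftrightarrow> A \<in> X"
  by (simp add: ket_def ket_space_def)

lemma ket_space_mono: "X \<subseteq> Y \<Longrightarrow> ket_space X \<subseteq> ket_space Y"
  by (auto simp: ket_space_def)

lemma ket_space_empty: "ket_space {} = {0}"
  by (auto simp: ket_space_def)

lemma lin_mem:
  assumes "fock.subspace P" "\<And>A. A \<in> Poly_Mapping.keys v \<Longrightarrow> g A \<in> P"
  shows "lin g v \<in> P"
  unfolding lin_def using assms by (intro fock.subspace_sum fock.subspace_scale)

lemma lin_ket_id: "lin ket v = v"
proof (rule poly_mapping_eqI)
  fix A
  have "Poly_Mapping.lookup (lin ket v) A
      = (\<Sum>B\<in>Poly_Mapping.keys v. if B = A then Poly_Mapping.lookup v A else 0)"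
    unfolding lin_def lookup_sum by (intro sum.cong) (auto simp: ket_def lookup_single when_def)
  then show "Poly_Mapping.lookup (lin ket v) A = Poly_Mapping.lookup v A"
    by (simp add: in_keys_iff)
qed

lemma ket_space_subset:
  assumes "fock.subspace P" "\<And>A. A \<in> X \<Longrightarrow> ket A \<in> P"
  shows "ket_space X \<subseteq> P"
proof
  fix v assume "v \<in> ket_space X"
  then have "lin ket v \<in> P" using assms by (intro lin_mem) (auto simp: ket_space_def)
  then show "v \<in> P" by (simp add: lin_ket_id)
qed

lemma subspace_Sum_any:
  assumes "fock.subspace P" "\<And>x. f x \<in> P"
  shows "Sum_any f \<in> P"
  unfolding Sum_any.expand_set using assms by (intro fock.subspace_sum) auto

lemma act_ket_space:
  assumes "\<And>A. A \<in> X \<Longrightarrow> act x (ket A) \<in> ket_space Y" "v \<in> ket_space X"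
  shows "act x v \<in> ket_space Y"
proof -
  have "fock.subspace {v. act x v \<in> ket_space Y}"
    using subspace_ket_space[of Y] by (auto simp: fock.subspace_def act_add act_scale)
  then have "ket_space X \<subseteq> {v. act x v \<in> ket_space Y}"
    by (rule ket_space_subset) (use assms in auto)
  then show ?thesis using assms(2) by auto
qed

section \<open>Weight, length and parity under the mode action\<close>

lemma weight_insert: "finite A \<Longrightarrow> x \<notin> A \<Longrightarrow> weight (insert x A) = weight A - index x"
  by (simp add: weight_def)

lemma weight_remove: "finite A \<Longrightarrow> x \<in> A \<Longrightarrow> weight (A - {x}) = weight A + index x"
  using weight_insert[of "A - {x}" x] by (simp add: insert_absorb)

lemma weight_nonneg: "A \<in> sector S b \<Longrightarrow> 0 \<le> weight A"
  unfolding weight_def by (intro sum_nonneg) (auto simp: sector_def creation_modes_def)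

text \<open>A negative mode inserts itself, and any other mode removes a partner of opposite index.
  In both cases the weight drops by \<open>index x\<close>, while the length changes by exactly
  one.\<close>

lemma act_ket:
  assumes A: "finite A" "A \<subseteq> creation_modes S" and x: "index x \<in> S"
  shows "act x (ket A) \<in> ket_space {B. finite B \<and> B \<subseteq> creation_modes S \<and> weight B = weight A - index x
           \<and> (if index x < 0 then card B = Suc (card A) else card A = Suc (card B))}"
    (is "_ \<in> ket_space ?Y")
proof (cases "index x < 0")
  case True
  then show ?thesis using assms
    by (auto simp: act_def create_def weight_insert creation_modes_def
        intro!: fock.subspace_scale fock.subspace_0 subspace_ket_space)
next
  case False
  have "contract (Mode k (- index x)) A \<in> ket_space ?Y" for k
  proof (cases "Mode k (- index x) \<in> A")
    case True
    then have "card A = Suc (card (A - {Mode k (- index x)}))"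
      using A by (metis card.remove)
    then have "A - {Mode k (- index x)} \<in> ?Y"
      using True A False by (auto simp: weight_remove)
    then have "ket (A - {Mode k (- index x)}) \<in> ket_space ?Y" by (simp only: ket_in_ket_space)
    then show ?thesis using True
      by (simp only: contract_def if_True fock.subspace_scale[OF subspace_ket_space])
  next
    case notin: False
    then show ?thesis by (simp only: contract_def if_False fock.subspace_0[OF subspace_ket_space])
  qed
  then show ?thesis using False
    unfolding act_def lin_ket if_not_P[OF False]
    by (intro fock.subspace_sum[OF subspace_ket_space] fock.subspace_scale[OF subspace_ket_space])
qed

lemma act_sector:
  assumes "v \<in> ket_space (sector S b)" "index x \<in> S"
  shows "act x v \<in> ket_space (sector S (\<not> b))"
proof (rule act_ket_space[OF _ assms(1)])
  fix A assume A: "A \<in> sector S b"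
  have "{B. finite B \<and> B \<subseteq> creation_modes S \<and> weight B = weight A - index x
           \<and> (if index x < 0 then card B = Suc (card A) else card A = Suc (card B))}
      \<subseteq> sector S (\<not> b)" (is "?Z \<subseteq> _")
  proof
    fix B assume B: "B \<in> ?Z"
    then have "even (card B) = odd (card A)" by (simp split: if_splits)
    then show "B \<in> sector S (\<not> b)" using A B by (simp add: sector_def)
  qed
  moreover have "act x (ket A) \<in> ket_space ?Z"
    using A assms(2) by (intro act_ket) (auto simp: sector_def)
  ultimately show "act x (ket A) \<in> ket_space (sector S (\<not> b))" using ket_space_mono by blast
qed

lemma nord_sector:
  "v \<in> ket_space (sector S b) \<Longrightarrow> \<forall>x\<in>set w. index x \<in> S \<Longrightarrow>
    nord w v \<in> ket_space (sector S (b = even (length w)))"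
proof (induction w arbitrary: v b)
  case (Cons x w)
  show ?case
  proof (cases "index x < 0")
    case True
    have "act x (nord w v) \<in> ket_space (sector S (\<not> (b = even (length w))))"
      using Cons by (intro act_sector) auto
    moreover have "(\<not> (b = even (length w))) = (b = even (length (x # w)))" by auto
    ultimately show ?thesis using True by simp
  next
    case False
    have "act x v \<in> ket_space (sector S (\<not> b))" using Cons.prems by (intro act_sector) auto
    then have "nord w (act x v) \<in> ket_space (sector S ((\<not> b) = even (length w)))"
      using Cons by auto
    moreover have "((\<not> b) = even (length w)) = (b = even (length (x # w)))" by auto
    ultimately show ?thesis using False
      by (simp add: fock.subspace_scale subspace_ket_space)
  qed
qed simp

lemma nord_pair:
  "nord [x, y] u = (if index x < 0 then act x (act y u) else - act y (act x u))"
  by simp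

text \<open>Each factor changes the length by one, so the length can grow only if both factors
  create. This bound on \<open>card B\<close> is what makes the terms with an annihilating factor
  harmless in the induction of \<open>ket_mem\<close>.\<close>

lemma nord_pair_ket:
  assumes A: "A \<in> sector S b" and "index x \<in> S" "index y \<in> S"
  shows "nord [x, y] (ket A) \<in> ket_space {B \<in> sector S b. weight B = weight A - index x - index y
           \<and> (index x < 0 \<and> index y < 0 \<or> card B \<le> card A)}"
    (is "_ \<in> ket_space ?Y")
proof -
  \<comment> \<open>Proved for arbitrary \<open>x\<close> and \<open>y\<close>, since normal
    ordering may exchange the two factors.\<close>
  have *: "act x (act y (ket A)) \<in> ket_space {B \<in> sector S b. weight B = weight A - index x - index y
           \<and> (index x < 0 \<and> index y < 0 \<or> card B \<le> card A)}"
    if "index x \<in> S" "index y \<in> S" for x y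
  proof (rule act_ket_space)
    show "act y (ket A) \<in> ket_space {B. finite B \<and> B \<subseteq> creation_modes S \<and> weight B = weight A - index y
           \<and> (if index y < 0 then card B = Suc (card A) else card A = Suc (card B))}"
      using A that by (intro act_ket) (auto simp: sector_def)
    fix B assume B: "B \<in> {B. finite B \<and> B \<subseteq> creation_modes S \<and> weight B = weight A - index y
           \<and> (if index y < 0 then card B = Suc (card A) else card A = Suc (card B))}"
    have "{D. finite D \<and> D \<subseteq> creation_modes S \<and> weight D = weight B - index x
           \<and> (if index x < 0 then card D = Suc (card B) else card B = Suc (card D))}
        \<subseteq> {B \<in> sector S b. weight B = weight A - index x - index y
           \<and> (index x < 0 \<and> index y < 0 \<or> card B \<le> card A)}" (is "?Z \<subseteq> ?Y")
    proof
      fix D assume D: "D \<in> ?Z"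
      have "even (card D) = even (card A)" "index x < 0 \<and> index y < 0 \<or> card D \<le> card A"
        using B D by (simp_all split: if_splits)
      then show "D \<in> ?Y" using A B D by (simp add: sector_def)
    qed
    moreover have "act x (ket B) \<in> ket_space ?Z" using B that by (intro act_ket) auto
    ultimately show "act x (ket B) \<in> ket_space ?Y" using ket_space_mono by blast
  qed
  have "{B \<in> sector S b. weight B = weight A - index y - index x
           \<and> (index y < 0 \<and> index x < 0 \<or> card B \<le> card A)} = ?Y"
    by (auto simp: algebra_simps)
  then have "act y (act x (ket A)) \<in> ket_space ?Y" using *[of y x] assms by simp
  then show ?thesis using *[of x y] assms
    unfolding nord_pair by (auto intro: fock.subspace_neg[OF subspace_ket_space])
qed

text \<open>Every letter of a word flips the parity of the sector, starting from \<open>vac\<close>;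
  conversely each \<open>ket A\<close> is the increasing word of \<open>A\<close>.\<close>

lemma word_span_eq:
  "fock.span {word_vec w | w. set w \<subseteq> creation_modes S \<and> even (length w) = b} = ket_space (sector S b)"
    (is "fock.span ?W = _")
proof
  have "word_vec w \<in> ket_space (sector S (even (length w)))" if "set w \<subseteq> creation_modes S" for w
    using that
  proof (induction w)
    case Nil show ?case by (simp add: word_vec_def sector_def)
  next
    case (Cons x w)
    then have "act x (word_vec w) \<in> ket_space (sector S (\<not> even (length w)))"
      by (intro act_sector) (auto simp: creation_modes_def)
    then show ?case by (simp add: word_vec_Cons)
  qed
  then show "fock.span ?W \<subseteq> ket_space (sector S b)"
    by (intro fock.span_minimal subspace_ket_space) auto
  show "ket_space (sector S b) \<subseteq> fock.span ?W"
  proof (rule ket_space_subset[OF fock.subspace_span])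
    fix A assume A: "A \<in> sector S b"
    then have "ket A = word_vec (sorted_list_of_set A)" by (intro ket_eq_word_vec) (auto simp: sector_def)
    then show "ket A \<in> fock.span ?W"
      using A by (intro fock.span_base) (auto simp: sector_def intro!: exI[of _ "sorted_list_of_set A"])
  qed
qed

lemma fock_even_eq: "fock_even S = ket_space (sector S True)"
  using word_span_eq[of S True] by (simp add: fock_even_def)

lemma fock_odd_eq: "fock_odd S = ket_space (sector S False)"
  using word_span_eq[of S False] by (simp add: fock_odd_def)

section \<open>Closure of the sectors under the products\<close>

lemma field_word_sector:
  assumes "u \<in> ket_space (sector S b)" "even (length w)"
  shows "field_word S w p u \<in> ket_space (sector S b)"
  unfolding field_word_def
proof (rule subspace_Sum_any[OF subspace_ket_space])
  fix ms :: "rat list"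
  let ?w = "map2 (\<lambda>x m. Mode (kind x) m) w ms"
  have "nord ?w u \<in> ket_space (sector S (b = even (length ?w)))"
    if "length ms = length w" "set ms \<subseteq> S"
    using that assms by (intro nord_sector) (auto dest: set_zip_rightD)
  then show "(if length ms = length w \<and> set ms \<subseteq> S
        \<and> (\<Sum>(x, m)\<leftarrow>zip w ms. - m - 1 - of_nat (deriv_order x)) = p
     then scale (of_rat (\<Prod>(x, m)\<leftarrow>zip w ms. (- m - 1) gchoose deriv_order x)) (nord ?w u)
     else 0) \<in> ket_space (sector S b)"
    using assms(2) by (auto intro: fock.subspace_scale fock.subspace_0 subspace_ket_space)
qed

lemma T_plus_eq: "T_plus = ket_space (sector int_modes True)"
  by (simp add: T_plus_def fock_even_eq)

lemma subspace_T_plus: "fock.subspace T_plus"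
  by (simp add: T_plus_eq subspace_ket_space)

lemma field_coeff_sector:
  assumes "u \<in> ket_space (sector S b)" "a \<in> T_plus"
  shows "field_coeff S a p u \<in> ket_space (sector S b)"
  unfolding field_coeff_def
  using assms by (intro lin_mem subspace_ket_space field_word_sector)
    (auto simp: T_plus_eq ket_space_def sector_def)

text \<open>\<Delta>(z) is quadratic in integral modes, so all its powers preserve the parity of the
  length.\<close>

lemma exp_Delta_T_plus: "a \<in> T_plus \<Longrightarrow> exp_Delta a k \<in> T_plus"
proof -
  assume a: "a \<in> T_plus"
  note sub = subspace_T_plus
  have "Delta_coeff k v \<in> T_plus" if "v \<in> T_plus" for k v
  proof -
    have "act x (act y v) \<in> T_plus" if "index x \<in> \<int>" "index y \<in> \<int>" for x y
      using act_sector[OF act_sector[of v int_modes True y], of x] that \<open>v \<in> T_plus\<close>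
      by (simp add: T_plus_eq int_modes_def)
    then show ?thesis
      unfolding Delta_coeff_def using sub by (intro fock.subspace_scale fock.subspace_sum) auto
  qed
  then have "Delta_series s k \<in> T_plus" if "\<And>i. s i \<in> T_plus" for s k
    unfolding Delta_series_def using sub that by (intro fock.subspace_sum) auto
  then have "(Delta_series ^^ j) (\<lambda>i. if i = 0 then a else 0) k \<in> T_plus" for j k
    by (induction j arbitrary: k) (simp_all add: a fock.subspace_0[OF sub])
  then show ?thesis
    unfolding exp_Delta_def using sub by (intro subspace_Sum_any fock.subspace_scale)
qed

lemma Y_mode_T_plus: "a \<in> T_plus \<Longrightarrow> u \<in> T_plus \<Longrightarrow> Y_mode a n u \<in> T_plus"
  using field_coeff_sector[of u int_modes True a] by (simp add: Y_mode_def T_plus_eq)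

lemma Y_theta_mode_sector:
  assumes "a \<in> T_plus" "u \<in> ket_space (sector half_modes b)"
  shows "Y_theta_mode a n u \<in> ket_space (sector half_modes b)"
  unfolding Y_theta_mode_def
  using assms by (intro subspace_Sum_any subspace_ket_space field_coeff_sector exp_Delta_T_plus)

context
  fixes Y :: "fock \<Rightarrow> int \<Rightarrow> fock \<Rightarrow> fock" and M :: "fock set"
  assumes M: "fock.subspace M"
    and Y_closed: "\<forall>a\<in>T_plus. \<forall>u\<in>M. \<forall>n. Y a n u \<in> M"
begin

lemma Y_ket_closed: "a \<in> T_plus \<Longrightarrow> A \<in> Poly_Mapping.keys a \<Longrightarrow> u \<in> M \<Longrightarrow> Y (ket A) n u \<in> M"
  using Y_closed ket_in_ket_space by (auto simp: T_plus_eq ket_space_def subset_iff)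

lemma circ_closed: "a \<in> T_plus \<Longrightarrow> u \<in> M \<Longrightarrow> circ Y a u \<in> M"
  unfolding circ_def by (intro lin_mem subspace_Sum_any fock.subspace_scale M Y_ket_closed)

lemma star_left_closed: "a \<in> T_plus \<Longrightarrow> u \<in> M \<Longrightarrow> star_left Y a u \<in> M"
  unfolding star_left_def by (intro lin_mem subspace_Sum_any fock.subspace_scale M Y_ket_closed)

lemma star_right_closed: "a \<in> T_plus \<Longrightarrow> u \<in> M \<Longrightarrow> star_right Y u a \<in> M"
  unfolding star_right_def by (intro lin_mem subspace_Sum_any fock.subspace_scale M Y_ket_closed)

lemma Zhu_O_subset: "Zhu_O Y M \<subseteq> M"
  unfolding Zhu_O_def using M by (intro fock.span_minimal) (auto simp: circ_closed)

text \<open>The closure conditions in \<open>sub_bimodule\<close> run over all representatives of a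
  class; because O(M) lies in M, none of them leaves M.\<close>

lemma Zhu_A_representative: "U \<in> Zhu_A Y M \<Longrightarrow> u \<in> U \<Longrightarrow> u \<in> M"
  using Zhu_O_subset M by (auto simp: Zhu_A_def Zhu_class_def intro: fock.subspace_add)

lemma Zhu_class_self: "u \<in> Zhu_class Y M u"
  by (auto simp: Zhu_class_def Zhu_O_def intro: exI[of _ 0] fock.span_zero)

end

text \<open>Puts \<open>Zhu_A Y M\<close> itself into the family intersected by
  \<open>bimodule_span\<close>, which gives the easy inclusion.\<close>

lemma sub_bimodule_Zhu_A:
  assumes "fock.subspace M" "\<forall>a\<in>T_plus. \<forall>u\<in>M. \<forall>n. Y a n u \<in> M"
  shows "sub_bimodule Y M (Zhu_A Y M)"
proof -
  note rep = Zhu_A_representative[OF assms]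
  have repT: "a \<in> T_plus" if "\<alpha> \<in> Zhu_A Y_mode T_plus" "a \<in> \<alpha>" for a \<alpha>
    by (rule Zhu_A_representative[OF subspace_T_plus _ that]) (simp add: Y_mode_T_plus)
  have cl: "Zhu_class Y M u \<in> Zhu_A Y M" if "u \<in> M" for u
    using that by (simp add: Zhu_A_def)
  show ?thesis
    unfolding sub_bimodule_def
  proof (intro conjI allI ballI)
    fix U V u v assume UV: "U \<in> Zhu_A Y M" "V \<in> Zhu_A Y M" "u \<in> U" "v \<in> V"
    from rep[OF UV(1,3)] rep[OF UV(2,4)] show "Zhu_class Y M (u + v) \<in> Zhu_A Y M"
      using assms(1) by (intro cl fock.subspace_add)
  next
    fix c U u assume "U \<in> Zhu_A Y M" "u \<in> U"
    then have "u \<in> M" by (rule rep)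
    then show "Zhu_class Y M (scale c u) \<in> Zhu_A Y M"
      using assms(1) by (intro cl fock.subspace_scale)
  next
    fix \<alpha> U a u assume *: "\<alpha> \<in> Zhu_A Y_mode T_plus" "U \<in> Zhu_A Y M" "a \<in> \<alpha>" "u \<in> U"
    from repT[OF *(1,3)] rep[OF *(2,4)] show "Zhu_class Y M (star_left Y a u) \<in> Zhu_A Y M" "Zhu_class Y M (star_right Y u a) \<in> Zhu_A Y M"
      by (simp_all add: cl star_left_closed[OF assms] star_right_closed[OF assms])
  next
    show "Zhu_class Y M 0 \<in> Zhu_A Y M" using fock.subspace_0[OF assms(1)] by (rule cl)
  qed auto
qed

text \<open>The preimage of a sub-bimodule is a subspace stable under both actions, so that it suffices to
  generate \<open>M\<close> itself by the two actions.\<close>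

lemma bimodule_span_eqI:
  assumes M: "fock.subspace M" and Y: "\<forall>a\<in>T_plus. \<forall>u\<in>M. \<forall>n. Y a n u \<in> M"
    and "G \<subseteq> M"
    and gen: "\<And>P. fock.subspace P \<Longrightarrow> G \<subseteq> P \<Longrightarrow>
      \<forall>a\<in>T_plus. \<forall>u\<in>P. star_left Y a u \<in> P \<Longrightarrow>
      \<forall>a\<in>T_plus. \<forall>u\<in>P. star_right Y u a \<in> P \<Longrightarrow> M \<subseteq> P"
  shows "bimodule_span Y M (Zhu_class Y M ` G) = Zhu_A Y M"
proof
  show "bimodule_span Y M (Zhu_class Y M ` G) \<subseteq> Zhu_A Y M"
    unfolding bimodule_span_def
  proof (rule Inter_lower, intro CollectI conjI)
    show "sub_bimodule Y M (Zhu_A Y M)" by (rule sub_bimodule_Zhu_A[OF M Y])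
    show "Zhu_class Y M ` G \<subseteq> Zhu_A Y M" using assms(3) by (auto simp: Zhu_A_def)
  qed
next
  have "Zhu_A Y M \<subseteq> N" if N: "sub_bimodule Y M N" "Zhu_class Y M ` G \<subseteq> N" for N
  proof -
    let ?P = "{u. Zhu_class Y M u \<in> N}"
    note self = Zhu_class_self[OF M Y]
    have N_add: "\<forall>U\<in>N. \<forall>V\<in>N. \<forall>u\<in>U. \<forall>v\<in>V. Zhu_class Y M (u + v) \<in> N"
      and N_scale: "\<forall>c. \<forall>U\<in>N. \<forall>u\<in>U. Zhu_class Y M (scale c u) \<in> N"
      and N_star: "\<forall>\<alpha>\<in>Zhu_A Y_mode T_plus. \<forall>U\<in>N. \<forall>a\<in>\<alpha>. \<forall>u\<in>U.
        Zhu_class Y M (star_left Y a u) \<in> N \<and> Zhu_class Y M (star_right Y u a) \<in> N"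
      and N_zero: "Zhu_class Y M 0 \<in> N"
      using N(1) unfolding sub_bimodule_def by simp_all
    have add: "Zhu_class Y M (u + v) \<in> N" if "Zhu_class Y M u \<in> N" "Zhu_class Y M v \<in> N" for u v
      by (rule N_add[rule_format, OF that self self])
    have scl: "Zhu_class Y M (scale c u) \<in> N" if "Zhu_class Y M u \<in> N" for c u
      by (rule N_scale[rule_format, OF that self])
    have star: "Zhu_class Y M (star_left Y a u) \<in> N \<and> Zhu_class Y M (star_right Y u a) \<in> N"
      if "a \<in> T_plus" "Zhu_class Y M u \<in> N" for a u
    proof -
      have \<alpha>: "Zhu_class Y_mode T_plus a \<in> Zhu_A Y_mode T_plus" using that(1) by (simp add: Zhu_A_def)
      have a: "a \<in> Zhu_class Y_mode T_plus a"
        by (rule Zhu_class_self[OF subspace_T_plus]) (simp add: Y_mode_T_plus)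
      show ?thesis by (rule N_star[rule_format, OF \<alpha> that(2) a self])
    qed
    have "M \<subseteq> ?P"
    proof (rule gen)
      show "fock.subspace ?P" using add scl N_zero by (simp add: fock.subspace_def)
      show "G \<subseteq> ?P" using N(2) by blast
    qed (use star in auto)
    then show ?thesis by (auto simp: Zhu_A_def)
  qed
  then show "Zhu_A Y M \<subseteq> bimodule_span Y M (Zhu_class Y M ` G)"
    unfolding bimodule_span_def by blast
qed

section \<open>Quadratic vertex operators\<close>

lemma Sum_any_scale: "Sum_any (\<lambda>x. scale c (f x)) = scale c (Sum_any f)"
proof (cases "c = 0")
  case False
  then have "{x. scale c (f x) \<noteq> 0} = {x. f x \<noteq> 0}" by simp
  then show ?thesis by (simp add: Sum_any.expand_set fock.scale_sum_right)
qed simp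

lemma Sum_any_reindex_range:
  assumes "inj \<phi>" "\<And>y. y \<notin> range \<phi> \<Longrightarrow> g y = 0"
  shows "Sum_any g = Sum_any (\<lambda>x. g (\<phi> x))"
proof -
  have "{y. g y \<noteq> 0} = \<phi> ` {x. g (\<phi> x) \<noteq> 0}" using assms(2) by force
  then show ?thesis
    unfolding Sum_any.expand_set using assms(1) by (simp add: sum.reindex inj_on_subset)
qed

section \<open>The correction by \<Delta>(z) on quadratic vectors\<close>

lemma Delta_coeff_scale: "Delta_coeff k (scale c v) = scale c (Delta_coeff k v)"
  by (simp add: Delta_coeff_def act_scale fock.scale_sum_right ac_simps)

lemma exp_Delta_scale: "exp_Delta (scale c v) k = scale c (exp_Delta v k)"
proof -
  have "(Delta_series ^^ j) (\<lambda>i. if i = 0 then scale c v else 0)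
      = (\<lambda>k. scale c ((Delta_series ^^ j) (\<lambda>i. if i = 0 then v else 0) k))" for j
    by (induction j) (auto simp: fun_eq_iff Delta_series_def Delta_coeff_scale fock.scale_sum_right)
  then show ?thesis
    unfolding exp_Delta_def by (simp add: ac_simps flip: Sum_any_scale)
qed

lemma field_coeff_scale: "field_coeff S (scale c v) p u = scale c (field_coeff S v p u)"
  by (simp add: field_coeff_def lin_scale)

lemma Y_theta_mode_scale: "Y_theta_mode (scale c a) n u = scale c (Y_theta_mode a n u)"
  by (simp add: Y_theta_mode_def exp_Delta_scale field_coeff_scale Sum_any_scale)

text \<open>The products take the weight from a basis vector, whereas \<open>word_vec [x, y]\<close>
  is one only up to a sign, or is zero. The scalar is moved inside the mode, so that the weight can
  still be read off \<open>B\<close>.\<close>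

lemma star_left_scale_ket:
  "star_left Y_theta_mode (scale c (ket B)) u
     = Sum_any (\<lambda>i. scale (of_rat (weight B) gchoose i) (Y_theta_mode (scale c (ket B)) (int i - 1) u))"
proof -
  have "star_left Y_theta_mode (scale c (ket B)) u
      = Sum_any (\<lambda>i. scale c (scale (of_rat (weight B) gchoose i) (Y_theta_mode (ket B) (int i - 1) u)))"
    by (simp only: star_left_def lin_scale lin_ket Sum_any_scale)
  then show ?thesis by (simp add: Y_theta_mode_scale mult.commute)
qed

lemma star_right_scale_ket:
  "star_right Y_theta_mode u (scale c (ket B))
     = Sum_any (\<lambda>i. scale ((of_rat (weight B) - 1) gchoose i) (Y_theta_mode (scale c (ket B)) (int i - 1) u))"
proof -
  have "star_right Y_theta_mode u (scale c (ket B))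
      = Sum_any (\<lambda>i. scale c (scale ((of_rat (weight B) - 1) gchoose i) (Y_theta_mode (ket B) (int i - 1) u)))"
    by (simp only: star_right_def lin_scale lin_ket Sum_any_scale)
  then show ?thesis by (simp add: Y_theta_mode_scale mult.commute)
qed

text \<open>Wick's rule: moving \<open>q\<close> to the right yields contractions with
  \<open>x\<close> and \<open>y\<close> with opposite signs, and \<open>p\<close> contracts with the
  mode that is left. The terms in which \<open>p\<close> or \<open>q\<close> reaches
  \<open>vac\<close> vanish.\<close>

lemma act_act_word_pair:
  assumes "index p \<ge> 0" "index q \<ge> 0"
  shows "act p (act q (word_vec [x, y]))
    = scale (bracket q x * bracket p y - bracket q y * bracket p x) vac"
proof -
  have sw: "act a (act b v) = scale (bracket a b) v - act b (act a v)" if "v \<in> finite_kets" for a b v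
    using act_anticommute_finite_kets[OF that, of a b] by (simp add: algebra_simps)
  have 1: "act a (act b vac) = scale (bracket a b) vac" if "index a \<ge> 0" for a b
    using sw[OF vac_finite_kets] that by (simp add: act_vac)
  have sub: "act p (v - w) = act p v - act p w" for v w
    using act_add[of p v "- w"] by (simp add: act_minus)
  have "act q (act x (act y vac)) = scale (bracket q x) (act y vac) - scale (bracket q y) (act x vac)"
    using sw[OF act_finite_kets[OF vac_finite_kets, of y], of q x]
    by (simp add: 1[OF assms(2)] act_scale)
  then show ?thesis
    using assms by (simp add: word_vec_def sub act_scale 1 fock.scale_left_diff_distrib)
qed

text \<open>\<Delta>(z) contracts both modes and leaves a multiple of \<open>vac\<close>, which it
  then annihilates, so the exponential stops after the linear term. The brackets force the two
  contracting indices to be \<open>i + 1\<close> and \<open>j + 1\<close>, whence the single degree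
  \<open>i + j + 2\<close>.\<close>

lemma exp_Delta_pair:
  assumes x: "index x = - of_nat (Suc i)" and y: "index y = - of_nat (Suc j)"
  obtains \<delta> where "\<And>k. exp_Delta (word_vec [x, y]) k
    = (if k = 0 then word_vec [x, y] else 0) + (if k = i + j + 2 then scale \<delta> vac else 0)"
proof -
  let ?a = "word_vec [x, y]"
  define \<beta> where "\<beta> p q = bracket q x * bracket p y - bracket q y * bracket p x" for p q
  define \<gamma> where "\<gamma> k = 2 * (\<Sum>m\<le>k. c_coeff m (k - m)
      * \<beta> (Mode E (of_nat m)) (Mode F (of_nat (k - m))))" for k
  have a: "Delta_coeff k ?a = scale (\<gamma> k) vac" for k
  proof -
    have "act (Mode E (of_nat m)) (act (Mode F (of_nat (k - m))) ?a)
        = scale (\<beta> (Mode E (of_nat m)) (Mode F (of_nat (k - m)))) vac" for m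
      unfolding \<beta>_def by (rule act_act_word_pair) auto
    then show ?thesis
      by (simp only: Delta_coeff_def \<gamma>_def fock.scale_scale fock.scale_sum_left[symmetric])
  qed
  have \<gamma>: "\<gamma> k = 0" if "k \<noteq> i + j + 2" for k
  proof -
    have "\<beta> (Mode E (of_nat m)) (Mode F (of_nat (k - m))) = 0" if "m \<le> k" for m
    proof -
      have "bracket (Mode f (of_nat l)) z = 0" if "index z = - of_nat (Suc n)" "l \<noteq> Suc n" for f l z n
      proof -
        have "(of_nat l :: rat) + - of_nat (Suc n) \<noteq> 0"
          using that(2) by (metis add.right_inverse add_right_cancel eq_neg_iff_add_eq_0 minus_minus of_nat_eq_iff)
        then show ?thesis using that(1) by (simp add: bracket_def del: of_nat_Suc)
      qed
      note this[OF x] this[OF y]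
      moreover have "k - m \<noteq> Suc i \<or> m \<noteq> Suc j" "k - m \<noteq> Suc j \<or> m \<noteq> Suc i"
        using \<open>k \<noteq> i + j + 2\<close> \<open>m \<le> k\<close> by auto
      ultimately show ?thesis unfolding \<beta>_def by (metis diff_zero mult_eq_0_iff)
    qed
    then show ?thesis by (simp add: \<gamma>_def)
  qed
  have zero: "Delta_coeff k 0 = 0" for k
    using Delta_coeff_scale[of k 0 0] by simp
  have vac: "Delta_coeff k (scale c vac) = 0" for k c
    by (simp add: Delta_coeff_def act_scale act_vac)
  let ?s = "\<lambda>j. (Delta_series ^^ j) (\<lambda>i. if i = 0 then ?a else 0)"
  have s1: "?s 1 = (\<lambda>k. scale (\<gamma> k) vac)"
  proof
    fix k
    have "?s 1 k = (\<Sum>j\<le>k. if j = k then Delta_coeff k ?a else 0)"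
      unfolding funpow_0 One_nat_def funpow.simps comp_def id_apply Delta_series_def
      by (intro sum.cong) (auto simp: zero)
    then show "?s 1 k = scale (\<gamma> k) vac" by (simp add: a)
  qed
  have step: "?s (Suc j) = Delta_series (?s j)" for j by simp
  have s2: "?s (Suc (Suc j)) = (\<lambda>_. 0)" for j
  proof (induction j)
    case 0
    have "?s (Suc (Suc 0)) = Delta_series (?s 1)" using step[of 1] by simp
    then show ?case unfolding s1 by (simp add: fun_eq_iff Delta_series_def vac)
  next
    case (Suc j)
    show ?case unfolding step[of "Suc (Suc j)"] Suc by (simp add: fun_eq_iff Delta_series_def zero)
  qed
  have "exp_Delta ?a k = (if k = 0 then ?a else 0) + scale (\<gamma> k) vac" for k
  proof -
    let ?g = "\<lambda>j. scale (1 / fact j) (?s j k)"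
    have "?g j = 0" if "j \<notin> {0, 1}" for j
    proof -
      have "\<exists>l. j = Suc (Suc l)" using that by (intro exI[of _ "j - 2"]) auto
      then obtain l where "j = Suc (Suc l)" ..
      then show ?thesis using s2[of l] by simp
    qed
    then have "{j. ?g j \<noteq> 0} \<subseteq> {0, 1}" by blast
    then have "exp_Delta ?a k = sum ?g {0, 1}"
      unfolding exp_Delta_def by (intro Sum_any.expand_superset) auto
    also have "\<dots> = (if k = 0 then ?a else 0) + scale (\<gamma> k) vac"
      using s1 by simp
    finally show ?thesis .
  qed
  then show thesis using \<gamma> by (intro that[of "\<gamma> (i + j + 2)"]) auto
qed

lemma field_coeff_vac: "field_coeff S vac p u = (if p = 0 then u else 0)"
proof -
  have "field_word S [] p u = (\<Sum>ms\<in>{[]}. if p = 0 then u else 0)"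
    unfolding field_word_def by (subst Sum_any.expand_superset[of "{[]}"]) auto
  then show ?thesis by (simp add: field_coeff_def)
qed

text \<open>The weight \<open>f\<close> is evaluated at \<open>x = -m-1\<close>, in which the coefficient of \<open>h\<^bsub>(m)\<^esub>\<close> in \<open>\<partial>\<^bsup>(i)\<^esup>h(z)\<close> is
  \<open>x choose i\<close>. Junk: \<open>Sum_any\<close> is \<open>0\<close> on infinite support, which \<open>bilinear_mode_support\<close> excludes.\<close>

definition bilinear_mode :: "fermion \<Rightarrow> fermion \<Rightarrow> rat \<Rightarrow> (rat \<Rightarrow> rat) \<Rightarrow> fock \<Rightarrow> fock" where
  "bilinear_mode h k N f u = Sum_any (\<lambda>m. if m \<in> half_modes
     then scale (of_rat (f (- m - 1))) (nord [Mode h m, Mode k (- N - m)] u) else 0)"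

lemma half_modes_reflect:
  assumes "N \<in> \<int>" shows "- N - m \<in> half_modes \<longleftrightarrow> m \<in> half_modes"
proof -
  have "- N - m - 1/2 = - (N + 1) - (m - 1/2)" "m - 1/2 = - (N + 1) - (- N - m - 1/2)"
    by (simp_all add: field_simps)
  then show ?thesis
    using assms unfolding half_modes_def by (metis Ints_1 Ints_add Ints_diff Ints_minus mem_Collect_eq)
qed

text \<open>The exponent condition forces the two mode indices to add up to \<open>- N\<close>,
  which leaves one free index \<open>m\<close>. With \<open>x = - m - 1\<close> the second binomial
  has argument \<open>N - 2 - x\<close>.\<close>

lemma field_word_pair:
  fixes i j n :: nat
  defines "N \<equiv> of_nat (i + j + 2) - of_nat n"
  shows "field_word half_modes [Mode h (- of_nat (Suc i)), Mode k (- of_nat (Suc j))] (- of_nat n) u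
    = bilinear_mode h k N (\<lambda>x. (x gchoose i) * ((N - 2 - x) gchoose j)) u"
proof -
  let ?w = "[Mode h (- of_nat (Suc i)), Mode k (- of_nat (Suc j))]"
  define g where "g ms =
    (if length ms = length ?w \<and> set ms \<subseteq> half_modes
        \<and> (\<Sum>(x, m)\<leftarrow>zip ?w ms. - m - 1 - of_nat (deriv_order x)) = - of_nat n
     then scale (of_rat (\<Prod>(x, m)\<leftarrow>zip ?w ms. (- m - 1) gchoose deriv_order x))
            (nord (map2 (\<lambda>x m. Mode (kind x) m) ?w ms) u)
     else 0)" for ms
  have ord: "deriv_order (Mode f (- of_nat (Suc l))) = l" for f l
    unfolding deriv_order_def by (simp del: of_nat_Suc)
  have N: "N \<in> \<int>" by (simp add: N_def)
  let ?\<phi> = "\<lambda>m. [m, - N - m]"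
  have "field_word half_modes ?w (- of_nat n) u = Sum_any g"
    unfolding field_word_def g_def ..
  also have "\<dots> = Sum_any (\<lambda>m. g (?\<phi> m))"
  proof (rule Sum_any_reindex_range)
    show "inj ?\<phi>" by (simp add: inj_def)
    fix ms :: "rat list" assume ms: "ms \<notin> range ?\<phi>"
    show "g ms = 0"
    proof (rule ccontr)
      assume "g ms \<noteq> 0"
      then have *: "length ms = 2" "(\<Sum>(x, m)\<leftarrow>zip ?w ms. - m - 1 - of_nat (deriv_order x)) = - of_nat n"
        by (auto simp: g_def simp del: of_nat_Suc split: if_splits)
      then obtain m l where "ms = [m, l]"
        by (metis One_nat_def Suc_1 length_0_conv length_Suc_conv)
      moreover from this have "l = - N - m"
        using *(2) by (simp add: ord N_def algebra_simps del: of_nat_Suc)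
      ultimately show False using ms by auto
    qed
  qed
  also have "(\<lambda>m. g (?\<phi> m)) = (\<lambda>m. if m \<in> half_modes then
      scale (of_rat (((- m - 1) gchoose i) * ((N - 2 - (- m - 1)) gchoose j)))
        (nord [Mode h m, Mode k (- N - m)] u) else 0)"
  proof
    fix m
    have sum: "(\<Sum>(x, m)\<leftarrow>zip ?w (?\<phi> m). - m - 1 - of_nat (deriv_order x)) = - of_nat n"
      by (simp add: ord N_def algebra_simps del: of_nat_Suc)
    have "(- (- N - m) - 1) = N - 2 - (- m - 1)" by simp
    then have prod: "(\<Prod>(x, m)\<leftarrow>zip ?w (?\<phi> m). (- m - 1) gchoose deriv_order x)
        = ((- m - 1) gchoose i) * ((N - 2 - (- m - 1)) gchoose j)"
      by (simp add: ord add.commute del: of_nat_Suc)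
    show "g (?\<phi> m) = (if m \<in> half_modes then
      scale (of_rat (((- m - 1) gchoose i) * ((N - 2 - (- m - 1)) gchoose j)))
        (nord [Mode h m, Mode k (- N - m)] u) else 0)"
      unfolding g_def sum prod using half_modes_reflect[OF N] by simp
  qed
  finally show ?thesis by (simp only: bilinear_mode_def)
qed

lemma act_ket_nonzero:
  assumes "act x (ket A) \<noteq> 0" "index x \<ge> 0"
  shows "- index x \<in> index ` A"
proof (rule ccontr)
  assume "- index x \<notin> index ` A"
  then have "Mode k (- index x) \<notin> A" for k by (metis image_eqI mode.sel(2))
  then show False using assms by (simp add: act_def contract_def)
qed

lemma finite_half_modes_interval: "finite (half_modes \<inter> {- N <..< 0})"
proof (rule finite_subset)
  show "half_modes \<inter> {- N <..< 0} \<subseteq> (\<lambda>z. of_int z + 1/2) ` {\<lfloor>- N\<rfloor> - 1 .. 0}"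
  proof
    fix m assume m: "m \<in> half_modes \<inter> {- N <..< 0}"
    then obtain z where z: "m - 1/2 = of_int z" by (auto simp: half_modes_def elim: Ints_cases)
    have "of_int z < (0::rat)" using m z by (simp add: field_simps)
    moreover have "- N < of_int z + 1" using m z by (simp add: field_simps)
    ultimately have "z \<in> {\<lfloor>- N\<rfloor> - 1 .. 0}"
      using floor_less_iff[of "- N" "z + 1"] by simp
    then show "m \<in> (\<lambda>z. of_int z + 1/2) ` {\<lfloor>- N\<rfloor> - 1 .. 0}"
      using z by (intro image_eqI[of _ _ z]) (auto simp: field_simps)
  qed
qed simp

text \<open>Only finitely many pairs consist of two creating modes. In every other pair an
  annihilating mode acts first, by normal ordering, and needs a partner among the finitely many
  indices occurring in \<open>A\<close>.\<close>

lemma bilinear_mode_support: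
  assumes "finite A"
  shows "finite {m \<in> half_modes. nord [Mode h m, Mode k (- N - m)] (ket A) \<noteq> 0}"
proof (rule finite_subset)
  show "{m \<in> half_modes. nord [Mode h m, Mode k (- N - m)] (ket A) \<noteq> 0}
      \<subseteq> (half_modes \<inter> {- N <..< 0}) \<union> uminus ` index ` A \<union> (\<lambda>l. l - N) ` index ` A"
  proof
    fix m assume m: "m \<in> {m \<in> half_modes. nord [Mode h m, Mode k (- N - m)] (ket A) \<noteq> 0}"
    consider "m < 0" "- N - m < 0" | "m < 0" "- N - m \<ge> 0" | "m \<ge> 0" by linarith
    then show "m \<in> (half_modes \<inter> {- N <..< 0}) \<union> uminus ` index ` A \<union> (\<lambda>l. l - N) ` index ` A"
    proof cases
      case 1 then show ?thesis using m by auto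
    next
      case 2
      then have "act (Mode k (- N - m)) (ket A) \<noteq> 0" using m by (auto simp: nord_pair simp del: nord.simps)
      then have "N + m \<in> index ` A" using act_ket_nonzero[of "Mode k (- N - m)" A] 2 by (simp add: add.commute)
      then show ?thesis by force
    next
      case 3
      then have "act (Mode h m) (ket A) \<noteq> 0" using m by (auto simp: nord_pair simp del: nord.simps)
      then have "- m \<in> index ` A" using act_ket_nonzero[of "Mode h m" A] 3 by simp
      then show ?thesis by force
    qed
  qed
qed (use assms finite_half_modes_interval in auto)

text \<open>The summation range does not depend on \<open>f\<close>; linearity in \<open>f\<close>
  becomes linearity of finite sums.\<close>

lemma bilinear_mode_sum:
  assumes "finite A"
  shows "bilinear_mode h k N f (ket A)
    = (\<Sum>m\<in>{m \<in> half_modes. nord [Mode h m, Mode k (- N - m)] (ket A) \<noteq> 0}.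
        scale (of_rat (f (- m - 1))) (nord [Mode h m, Mode k (- N - m)] (ket A)))"
    (is "_ = sum _ ?D")
proof -
  have "bilinear_mode h k N f (ket A) = (\<Sum>m\<in>?D. if m \<in> half_modes
     then scale (of_rat (f (- m - 1))) (nord [Mode h m, Mode k (- N - m)] (ket A)) else 0)"
    unfolding bilinear_mode_def
    by (rule Sum_any.expand_superset[OF bilinear_mode_support[OF assms]]) (auto simp del: nord.simps)
  also have "\<dots> = (\<Sum>m\<in>?D. scale (of_rat (f (- m - 1))) (nord [Mode h m, Mode k (- N - m)] (ket A)))"
    by (rule sum.cong) auto
  finally show ?thesis .
qed

lemma bilinear_mode_add:
  "finite A \<Longrightarrow> bilinear_mode h k N (\<lambda>x. f x + g x) (ket A)
    = bilinear_mode h k N f (ket A) + bilinear_mode h k N g (ket A)"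
  by (simp only: bilinear_mode_sum of_rat_add fock.scale_left_distrib sum.distrib)

lemma bilinear_mode_mult:
  "finite A \<Longrightarrow> bilinear_mode h k N (\<lambda>x. c * f x) (ket A) = scale (of_rat c) (bilinear_mode h k N f (ket A))"
  by (simp only: bilinear_mode_sum of_rat_mult fock.scale_sum_right fock.scale_scale)

lemma bilinear_mode_weight:
  assumes A: "A \<in> sector half_modes b" and N: "N \<in> \<int>"
  shows "bilinear_mode h k N f (ket A) \<in> ket_space {B \<in> sector half_modes b. weight B = weight A + N}"
  unfolding bilinear_mode_def
proof (rule subspace_Sum_any[OF subspace_ket_space])
  fix m
  have "nord [Mode h m, Mode k (- N - m)] (ket A)
      \<in> ket_space {B \<in> sector half_modes b. weight B = weight A + N}" if "m \<in> half_modes"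
    using nord_pair_ket[OF A, of "Mode h m" "Mode k (- N - m)"] that half_modes_reflect[OF N]
    by (auto simp: ket_space_def simp del: nord.simps)
  then show "(if m \<in> half_modes then scale (of_rat (f (- m - 1))) (nord [Mode h m, Mode k (- N - m)] (ket A)) else 0)
      \<in> ket_space {B \<in> sector half_modes b. weight B = weight A + N}"
    by (auto intro: fock.subspace_scale fock.subspace_0 subspace_ket_space simp del: nord.simps)
qed

text \<open>By \<open>exp_Delta_pair\<close> only two coefficients of the corrected vector count:
  the word itself, giving the bilinear operator, and a multiple of \<open>vac\<close>, whose field
  is constant in z and hence appears only at \<open>n = i + j + 2\<close>. The mode number
  \<open>int n - 1\<close> makes \<open>n\<close> the summation index of the star products.\<close>

lemma Y_theta_mode_pair:
  fixes i j :: nat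
  assumes u: "u \<in> fock_space S"
  obtains \<delta> where "\<And>n. Y_theta_mode (word_vec [Mode h (- of_nat (Suc i)), Mode k (- of_nat (Suc j))]) (int n - 1) u
    = bilinear_mode h k (of_nat (i + j + 2) - of_nat n)
        (\<lambda>x. (x gchoose i) * ((of_nat (i + j + 2) - of_nat n - 2 - x) gchoose j)) u
      + (if n = i + j + 2 then scale \<delta> u else 0)"
proof -
  let ?w = "[Mode h (- of_nat (Suc i)), Mode k (- of_nat (Suc j))]"
  let ?wt = "i + j + 2"
  obtain \<delta> where \<delta>: "\<And>n. exp_Delta (word_vec ?w) n
      = (if n = 0 then word_vec ?w else 0) + (if n = ?wt then scale \<delta> vac else 0)"
    by (rule exp_Delta_pair[of "Mode h (- of_nat (Suc i))" i "Mode k (- of_nat (Suc j))" j])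
      (simp_all del: of_nat_Suc)
  have zero: "field_coeff half_modes 0 p u = 0" for p
    by (simp add: field_coeff_def)
  have "Y_theta_mode (word_vec ?w) (int n - 1) u
      = field_word half_modes ?w (- of_nat n) u + (if n = ?wt then scale \<delta> u else 0)" for n
  proof -
    let ?g = "\<lambda>l. field_coeff half_modes (exp_Delta (word_vec ?w) l) (of_int (- (int n - 1) - 1 + int l)) u"
    have "Y_theta_mode (word_vec ?w) (int n - 1) u = sum ?g {0, ?wt}"
      unfolding Y_theta_mode_def
      by (rule Sum_any.expand_superset) (auto simp: \<delta> zero simp del: of_nat_Suc)
    also have "\<dots> = ?g 0 + ?g ?wt" by simp
    also have "?g 0 = field_word half_modes ?w (- of_nat n) u"
      using field_word_vec[OF u, of ?w half_modes "- of_nat n"] by (simp add: \<delta> del: of_nat_Suc)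
    also have "?g ?wt = (if n = ?wt then scale \<delta> u else 0)"
      by (simp add: \<delta> field_coeff_scale field_coeff_vac del: of_nat_Suc)
    finally show ?thesis .
  qed
  then show thesis
    by (intro that[of \<delta>]) (simp only: field_word_pair)
qed

section \<open>Star products with quadratic vectors\<close>

lemma word_vec_pair_T_plus:
  "word_vec [Mode h (- of_nat (Suc i)), Mode k (- of_nat (Suc j))] \<in> T_plus"
  unfolding T_plus_def fock_even_def
  by (rule fock.span_base, rule CollectI,
      rule exI[of _ "[Mode h (- of_nat (Suc i)), Mode k (- of_nat (Suc j))]"])
    (auto simp: creation_modes_def int_modes_def)

lemma word_vec_pair_ket:
  obtains c B where "word_vec [Mode h (- of_nat (Suc i)), Mode k (- of_nat (Suc j))] = scale c (ket B)"
    "weight B = of_nat (i + j + 2)"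
proof -
  let ?x = "Mode h (- of_nat (Suc i))" and ?y = "Mode k (- of_nat (Suc j))"
  have w: "word_vec [?x, ?y] = create ?x {?y}"
    by (simp add: word_vec_def act_def create_def sgn_before_def)
  show thesis
  proof (cases "?x = ?y")
    case True
    \<comment> \<open>The square of a creating mode is zero, so any basis vector of the required
      weight serves with coefficient 0.\<close>
    have "weight {Mode E (- of_nat (i + j + 2))} = of_nat (i + j + 2)" by (simp add: weight_def)
    moreover have "word_vec [?x, ?y] = scale 0 (ket {Mode E (- of_nat (i + j + 2))})"
      unfolding w using True by (simp add: create_def)
    ultimately show thesis by (rule that[rotated])
  next
    case False
    then have "weight {?x, ?y} = of_nat (i + j + 2)" by (simp add: weight_def)
    moreover have "word_vec [?x, ?y] = scale (sgn_before ?x {?y}) (ket {?x, ?y})"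
      unfolding w create_def using False by (simp only: singleton_iff if_False)
    ultimately show thesis by (rule that[rotated])
  qed
qed

lemma sector_fock_space: "A \<in> sector S b \<Longrightarrow> ket A \<in> fock_space S"
  unfolding fock_space_def
  by (rule fock.span_base, rule CollectI, rule exI[of _ "sorted_list_of_set A"])
    (auto simp: sector_def ket_eq_word_vec[of A S])

text \<open>Both products are combinations of the same operators \<open>T n\<close> and differ only
  in their binomial coefficients; the correction by \<Delta>(z) enters through the multiples of
  \<open>ket A\<close>.\<close>

lemma star_pair:
  fixes i j :: nat and h k :: fermion
  assumes A: "A \<in> sector half_modes b"
  defines "T \<equiv> \<lambda>n. bilinear_mode h k (of_nat (i + j + 2) - of_nat n)
        (\<lambda>x. (x gchoose i) * ((of_nat (i + j + 2) - of_nat n - 2 - x) gchoose j)) (ket A)"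
    and "a \<equiv> word_vec [Mode h (- of_nat (Suc i)), Mode k (- of_nat (Suc j))]"
  obtains c1 c2 K where "1 \<le> K"
    "star_left Y_theta_mode a (ket A)
      = (\<Sum>n\<le>K. scale (of_nat (i + j + 2) gchoose n) (T n)) + scale c1 (ket A)"
    "star_right Y_theta_mode (ket A) a
      = (\<Sum>n\<le>K. scale ((of_nat (i + j + 2) - 1) gchoose n) (T n)) + scale c2 (ket A)"
proof -
  let ?wt = "i + j + 2"
  define Y where "Y n = Y_theta_mode a (int n - 1) (ket A)" for n
  have "\<exists>\<delta>. \<forall>n. Y n = T n + (if n = ?wt then scale \<delta> (ket A) else 0)"
    unfolding Y_def T_def a_def
    by (rule Y_theta_mode_pair[OF sector_fock_space[OF A], where h = h and k = k and i = i and j = j]) blast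
  then obtain \<delta> where \<delta>: "\<And>n. Y n = T n + (if n = ?wt then scale \<delta> (ket A) else 0)" by blast
  \<comment> \<open>For larger \<open>n\<close> the operator \<open>T n\<close> would lower the
    weight of \<open>ket A\<close> below zero. The maximum keeps the correction at
    \<open>n = i + j + 2\<close> within the sum.\<close>
  define K where "K = max ?wt (nat \<lceil>weight A + of_nat ?wt\<rceil>)"
  have T: "T n = 0" if "n > K" for n
  proof -
    have "weight A + of_nat ?wt \<le> of_nat K" unfolding K_def by linarith
    also have "\<dots> < of_nat n" using that by simp
    finally have neg: "weight A + (of_nat ?wt - of_nat n) < 0" by simp
    have "B \<notin> sector half_modes b" if "weight B = weight A + (of_nat ?wt - of_nat n)" for B
      using weight_nonneg[of B half_modes b] neg that by auto
    then have empty: "{B \<in> sector half_modes b. weight B = weight A + (of_nat ?wt - of_nat n)} = {}" by blast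
    have "T n \<in> ket_space {B \<in> sector half_modes b. weight B = weight A + (of_nat ?wt - of_nat n)}"
      unfolding T_def by (rule bilinear_mode_weight[OF A]) simp
    then show ?thesis unfolding empty ket_space_empty by simp
  qed
  have sum: "Sum_any (\<lambda>n. scale (\<beta> n) (Y n)) = (\<Sum>n\<le>K. scale (\<beta> n) (T n)) + scale (\<beta> ?wt * \<delta>) (ket A)" for \<beta>
  proof -
    have "Y n = 0" if "n > K" for n using T[OF that] that by (simp add: \<delta> K_def)
    then have "Sum_any (\<lambda>n. scale (\<beta> n) (Y n)) = (\<Sum>n\<le>K. scale (\<beta> n) (Y n))"
      by (intro Sum_any.expand_superset) (auto simp: not_le[symmetric])
    also have "\<dots> = (\<Sum>n\<le>K. scale (\<beta> n) (T n)) + (\<Sum>n\<le>K. if n = ?wt then scale (\<beta> ?wt * \<delta>) (ket A) else 0)"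
      unfolding sum.distrib[symmetric] by (intro sum.cong) (auto simp: \<delta> fock.scale_right_distrib)
    also have "(\<Sum>n\<le>K. if n = ?wt then scale (\<beta> ?wt * \<delta>) (ket A) else 0) = scale (\<beta> ?wt * \<delta>) (ket A)"
      by (simp add: K_def)
    finally show ?thesis .
  qed
  obtain c B where B: "a = scale c (ket B)" "weight B = of_nat ?wt"
    unfolding a_def by (rule word_vec_pair_ket)
  have "star_left Y_theta_mode a (ket A) = Sum_any (\<lambda>n. scale (of_nat ?wt gchoose n) (Y n))"
    unfolding Y_def B(1) star_left_scale_ket B(2) of_rat_of_nat_eq ..
  moreover have "star_right Y_theta_mode (ket A) a = Sum_any (\<lambda>n. scale ((of_nat ?wt - 1) gchoose n) (Y n))"
    unfolding Y_def B(1) star_right_scale_ket B(2) of_rat_of_nat_eq ..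
  moreover have "1 \<le> K" by (simp add: K_def)
  ultimately show thesis unfolding sum by (rule that[rotated 1, OF _ _])
qed

section \<open>Generation by the two actions\<close>

lemma gchoose_poly:
  obtains p :: "rat poly" where "degree p \<le> i" "coeff p i \<noteq> 0" "\<And>x. poly p x = x gchoose i"
proof -
  let ?q = "\<Prod>l = 0..<i. [:- of_nat l, 1:] :: rat poly"
  let ?p = "smult (1 / fact i) ?q"
  have deg: "degree ?q = i" by (subst degree_prod_sum_eq) auto
  have "lead_coeff ?q = 1" by (simp add: lead_coeff_prod)
  then have "coeff ?q i = 1" by (simp only: deg)
  then show thesis
    by (intro that[of ?p]) (auto simp: deg poly_prod gbinomial_prod_rev)
qed

lemma gchoose_product_poly:
  fixes c :: rat
  obtains p :: "rat poly" where "degree p \<le> i + j" "\<And>x. poly p x = (x gchoose i) * ((c - x) gchoose j)"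
proof -
  obtain p q :: "rat poly" where p: "degree p \<le> i" "\<And>x. poly p x = x gchoose i"
    and q: "degree q \<le> j" "\<And>x. poly q x = x gchoose j"
    using gchoose_poly by metis
  have "degree (q \<circ>\<^sub>p [:c, -1:]) \<le> j" using q by (simp add: degree_pcompose)
  then have "degree (p * (q \<circ>\<^sub>p [:c, -1:])) \<le> i + j"
    using degree_mult_le[of p "q \<circ>\<^sub>p [:c, -1:]"] p(1) by linarith
  then show thesis
    using p q by (intro that[of "p * (q \<circ>\<^sub>p [:c, -1:])"]) (auto simp: poly_pcompose)
qed

text \<open>The polynomials in assumption \<open>lagrange\<close> are the Lagrange basis for the nodes \<open>0, \<dots>, d - 1\<close>.\<close>

lemma polynomial_span:
  fixes p :: "rat poly"
  assumes p: "degree p \<le> d"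
    and add: "\<And>p q. Q p \<Longrightarrow> Q q \<Longrightarrow> Q (p + q)" and smult: "\<And>c p. Q p \<Longrightarrow> Q (smult c p)" and zero: "Q 0"
    and lagrange: "\<And>i p. i < d \<Longrightarrow>
      (\<And>x. poly p x = (x gchoose i) * ((of_nat d - 1 - x) gchoose (d - 1 - i))) \<Longrightarrow> Q p"
    and top: "\<And>p. (\<And>x. poly p x = x gchoose d) \<Longrightarrow> Q p"
  shows "Q p"
proof -
  obtain b :: "rat poly" where b: "degree b \<le> d" "coeff b d \<noteq> 0" "\<And>x. poly b x = x gchoose d"
    using gchoose_poly by metis
  have "\<exists>q :: rat poly. degree q \<le> d - 1 \<and> (\<forall>x. poly q x = (x gchoose i) * ((of_nat d - 1 - x) gchoose (d - 1 - i)))"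
    if "i < d" for i
    using gchoose_product_poly[of i "d - 1 - i" "of_nat d - 1"] that by (metis Suc_pred' add_diff_inverse_nat diff_diff_left less_Suc_eq_le not_less less_nat_zero_code neq0_conv plus_1_eq_Suc)
  then obtain q :: "nat \<Rightarrow> rat poly" where q: "\<And>i. i < d \<Longrightarrow> degree (q i) \<le> d - 1"
    "\<And>i x. i < d \<Longrightarrow> poly (q i) x = (x gchoose i) * ((of_nat d - 1 - x) gchoose (d - 1 - i))"
    by metis
  have node: "poly (q i) (of_nat l) = (if l = i then 1 else 0)" if "i < d" "l < d" for i l
  proof -
    have diff: "(of_nat d - 1 - of_nat l :: rat) = of_nat (d - 1 - l)" using that by (simp add: of_nat_diff)
    have "poly (q i) (of_nat l) = of_nat ((l choose i) * ((d - 1 - l) choose (d - 1 - i)))"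
      unfolding q(2)[OF that(1)] diff by (simp only: binomial_gbinomial of_nat_mult)
    \<comment> \<open>The first factor vanishes for \<open>l < i\<close> and the second for
      \<open>l > i\<close>; at \<open>l = i\<close> both are 1.\<close>
    also have "(l choose i) * ((d - 1 - l) choose (d - 1 - i)) = (if l = i then 1 else 0)"
      using that by (cases l i rule: linorder_cases) (auto simp: binomial_eq_0)
    finally show ?thesis by simp
  qed
  \<comment> \<open>Subtracting the multiple of \<open>b\<close> kills the coefficient of degree
    \<open>d\<close>. The interpolant \<open>s\<close> then equals \<open>p'\<close>, as a nonzero
    difference would have degree less than \<open>d\<close> and yet \<open>d\<close> roots.\<close>
  define p' where "p' = p - smult (coeff p d / coeff b d) b"
  define s where "s = (\<Sum>i<d. smult (poly p' (of_nat i)) (q i))"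
  have "p' - s = 0"
  proof (rule ccontr)
    assume ne: "p' - s \<noteq> 0"
    have "coeff (q i) d = 0" if "i < d" for i using q(1)[OF that] that by (intro coeff_eq_0) linarith
    then have "coeff (p' - s) d = 0" using b(2) by (simp add: p'_def s_def coeff_sum)
    moreover have "degree (p' - s) \<le> d"
    proof (rule degree_diff_le)
      show "degree p' \<le> d" unfolding p'_def
        using p b(1) by (intro degree_diff_le) (auto intro: order_trans[OF degree_smult_le])
      show "degree s \<le> d" unfolding s_def
      proof (rule degree_sum_le)
        fix i assume "i \<in> {..<d}"
        then have "degree (q i) \<le> d" using q(1)[of i] by simp
        then show "degree (smult (poly p' (of_nat i)) (q i)) \<le> d"
          by (rule order_trans[OF degree_smult_le])
      qed simp
    qed
    ultimately have deg: "degree (p' - s) < d" using ne by (metis le_neq_implies_less leading_coeff_0_iff)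
    have "poly (p' - s) (of_nat l) = 0" if "l < d" for l
    proof -
      have "poly s (of_nat l) = (\<Sum>i<d. if l = i then poly p' (of_nat l) else 0)"
        unfolding s_def poly_sum by (intro sum.cong) (auto simp: node that)
      then show ?thesis using that by simp
    qed
    then have "of_nat ` {..<d} \<subseteq> {x. poly (p' - s) x = 0}" by blast
    then have "card ((of_nat :: nat \<Rightarrow> rat) ` {..<d}) \<le> degree (p' - s)"
      using card_mono[OF poly_roots_finite[OF ne]] card_poly_roots_bound[OF ne] by (meson order_trans)
    moreover have "card ((of_nat :: nat \<Rightarrow> rat) ` {..<d}) = d" by (simp add: card_image inj_on_def)
    ultimately show False using deg by simp
  qed
  then have eq: "p = smult (coeff p d / coeff b d) b + s" by (simp add: p'_def)
  have "Q (\<Sum>i\<in>I. smult (poly p' (of_nat i)) (q i))" if "finite I" "I \<subseteq> {..<d}" for I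
    using that
  proof (induction I)
    case (insert i I)
    then have i: "i < d" by simp
    have "Q (q i)" using q(2)[OF i] by (rule lagrange[OF i])
    then have "Q (smult (poly p' (of_nat i)) (q i))" by (rule smult)
    then show ?case using insert by (simp add: add)
  qed (simp add: zero)
  then have "Q s" by (simp add: s_def)
  moreover have "Q (smult (coeff p d / coeff b d) b)" using b(3) by (intro smult top)
  ultimately show ?thesis by (subst eq) (rule add)
qed

text \<open>\<open>P\<close> stands for the vectors whose classes lie in a given sub-bimodule, and
  \<open>b\<close> for the parity of the twisted module under consideration.\<close>

locale bimodule_closed =
  fixes P :: "fock set" and b :: bool
  assumes P: "fock.subspace P"
    and left: "\<forall>a\<in>T_plus. \<forall>u\<in>P. star_left Y_theta_mode a u \<in> P"
    and right: "\<forall>a\<in>T_plus. \<forall>u\<in>P. star_right Y_theta_mode u a \<in> P"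
begin

text \<open>Terms of weight below \<open>weight A + d + 1\<close> lie in \<open>P\<close> by
  \<open>low\<close>. Up to these and multiples of \<open>ket A\<close>, the left product with
  \<open>i + j = d - 1\<close> is its term \<open>n = 0\<close>, and the difference of both products
  with \<open>i = d\<close>, \<open>j = 0\<close> is its term \<open>n = 1\<close>. The coefficients
  so obtained span all degrees up to \<open>d\<close> by \<open>polynomial_span\<close>.\<close>

lemma bilinear_mode_mem:
  assumes A: "A \<in> sector half_modes b" "ket A \<in> P"
    and low: "\<And>B n. B \<in> sector half_modes b \<Longrightarrow> 1 \<le> n \<Longrightarrow>
      weight B = weight A + of_nat (Suc d) - of_nat n \<Longrightarrow> ket B \<in> P"
    and p: "degree p \<le> d"
  shows "bilinear_mode h k (of_nat (Suc d)) (poly p) (ket A) \<in> P"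
proof -
  let ?Q = "\<lambda>p. bilinear_mode h k (of_nat (Suc d)) (poly p) (ket A) \<in> P"
  have fin: "finite A" using A(1) by (simp add: sector_def)
  note sub = fock.subspace_add[OF P] fock.subspace_scale[OF P] fock.subspace_0[OF P] fock.subspace_diff[OF P]
  have cancel: "u \<in> P" if "u + v \<in> P" "v \<in> P" for u v
    using sub(4)[OF that] by simp
  let ?T = "\<lambda>h k i j n. bilinear_mode h k (of_nat (i + j + 2) - of_nat n)
        (\<lambda>x. (x gchoose i) * ((of_nat (i + j + 2) - of_nat n - 2 - x) gchoose j)) (ket A)"
  \<comment> \<open>The condition says that the shift \<open>i + j + 2 - n\<close> of the weight is
    less than \<open>d + 1\<close>.\<close>
  have T_low: "?T h k i j n \<in> P" if "i + j + 1 < d + n" for i j n h k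
  proof -
    let ?N = "of_nat (i + j + 2) - of_nat n :: rat"
    have "ket B \<in> P" if B: "B \<in> sector half_modes b" "weight B = weight A + ?N" for B
    proof (rule low[OF B(1), of "d + n - (i + j + 1)"])
      show "1 \<le> d + n - (i + j + 1)" using \<open>i + j + 1 < d + n\<close> by simp
      show "weight B = weight A + of_nat (Suc d) - of_nat (d + n - (i + j + 1))"
        using \<open>i + j + 1 < d + n\<close> B(2) by (simp add: of_nat_diff)
    qed
    then have "ket_space {B \<in> sector half_modes b. weight B = weight A + ?N} \<subseteq> P"
      by (intro ket_space_subset[OF P]) auto
    moreover have "?N \<in> \<int>" by simp
    ultimately show ?thesis using bilinear_mode_weight[OF A(1)] by blast
  qed
  show ?thesis
  proof (rule polynomial_span[OF p, of ?Q])
    fix p q assume "?Q p" "?Q q"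
    moreover have "poly (p + q) = (\<lambda>x. poly p x + poly q x)" by (simp add: fun_eq_iff)
    ultimately show "?Q (p + q)" by (simp only: bilinear_mode_add[OF fin] sub(1))
  next
    fix c p assume "?Q p"
    moreover have "poly (smult c p) = (\<lambda>x. c * poly p x)" by (simp add: fun_eq_iff)
    ultimately show "?Q (smult c p)" by (simp only: bilinear_mode_mult[OF fin] sub(2))
  next
    have "poly 0 = (\<lambda>x. 0 * poly 0 x :: rat)" by (simp add: fun_eq_iff)
    then show "?Q 0" by (metis bilinear_mode_mult[OF fin] fock.scale_zero_left of_rat_0 sub(3))
  next
    fix i and p :: "rat poly" assume i: "i < d"
      and p: "\<And>x. poly p x = (x gchoose i) * ((of_nat d - 1 - x) gchoose (d - 1 - i))"
    let ?j = "d - 1 - i"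
    obtain c K where c: "1 \<le> K" "star_left Y_theta_mode (word_vec [Mode h (- of_nat (Suc i)), Mode k (- of_nat (Suc ?j))]) (ket A)
      = (\<Sum>n\<le>K. scale (of_nat (i + ?j + 2) gchoose n) (?T h k i ?j n)) + scale c (ket A)"
      by (rule star_pair[OF A(1)])
    have "(\<Sum>n\<le>K. scale (of_nat (i + ?j + 2) gchoose n) (?T h k i ?j n)) \<in> P" (is "?S \<in> P")
    proof (rule cancel)
      show "?S + scale c (ket A) \<in> P"
        unfolding c(2)[symmetric] by (rule left[rule_format, OF word_vec_pair_T_plus A(2)])
    qed (rule sub(2)[OF A(2)])
    moreover have "(\<Sum>n\<in>{..K} - {0}. scale (of_nat (i + ?j + 2) gchoose n) (?T h k i ?j n)) \<in> P"
      using i by (intro fock.subspace_sum[OF P] sub(2) T_low) auto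
    ultimately have "scale (of_nat (i + ?j + 2) gchoose 0) (?T h k i ?j 0) \<in> P"
      using sum.remove[of "{..K}" 0 "\<lambda>n. scale (of_nat (i + ?j + 2) gchoose n) (?T h k i ?j n)"] cancel by simp
    moreover have "of_nat (i + ?j + 2) - of_nat 0 = (of_nat (Suc d) :: rat)" using i by (simp add: of_nat_diff)
    moreover have "of_nat (Suc d) - 2 - x = of_nat d - 1 - x" for x :: rat by simp
    moreover have "poly p = (\<lambda>x. (x gchoose i) * ((of_nat d - 1 - x) gchoose ?j))" using p by (rule ext)
    ultimately show "?Q p" by (simp only: gbinomial_0 fock.scale_one)
  next
    fix p :: "rat poly" assume p: "\<And>x. poly p x = x gchoose d"
    obtain c1 c2 K where c: "1 \<le> K"
      "star_left Y_theta_mode (word_vec [Mode h (- of_nat (Suc d)), Mode k (- of_nat (Suc 0))]) (ket A)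
        = (\<Sum>n\<le>K. scale (of_nat (d + 0 + 2) gchoose n) (?T h k d 0 n)) + scale c1 (ket A)"
      "star_right Y_theta_mode (ket A) (word_vec [Mode h (- of_nat (Suc d)), Mode k (- of_nat (Suc 0))])
        = (\<Sum>n\<le>K. scale ((of_nat (d + 0 + 2) - 1) gchoose n) (?T h k d 0 n)) + scale c2 (ket A)"
      by (rule star_pair[OF A(1)])
    \<comment> \<open>The acting vector has weight \<open>d + 2\<close>, so the term
      \<open>n = 0\<close> raises the weight beyond the reach of \<open>low\<close>; it cancels
      because its coefficient is 1 in both products. At \<open>n = 1\<close> the coefficients differ
      by \<open>(d + 2) - (d + 1) = 1\<close>.\<close>
    let ?f = "\<lambda>n. scale ((of_nat (d + 0 + 2) gchoose n) - ((of_nat (d + 0 + 2) - 1) gchoose n)) (?T h k d 0 n)"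
    have "(\<Sum>n\<le>K. scale (of_nat (d + 0 + 2) gchoose n) (?T h k d 0 n)) \<in> P" (is "?S \<in> P")
    proof (rule cancel)
      show "?S + scale c1 (ket A) \<in> P"
        unfolding c(2)[symmetric] by (rule left[rule_format, OF word_vec_pair_T_plus A(2)])
    qed (rule sub(2)[OF A(2)])
    moreover have "(\<Sum>n\<le>K. scale ((of_nat (d + 0 + 2) - 1) gchoose n) (?T h k d 0 n)) \<in> P" (is "?S \<in> P")
    proof (rule cancel)
      show "?S + scale c2 (ket A) \<in> P"
        unfolding c(3)[symmetric] by (rule right[rule_format, OF word_vec_pair_T_plus A(2)])
    qed (rule sub(2)[OF A(2)])
    ultimately have "(\<Sum>n\<le>K. ?f n) \<in> P"
      unfolding fock.scale_left_diff_distrib sum_subtractf by (rule sub(4))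
    moreover have "(\<Sum>n\<in>{..K} - {1}. ?f n) \<in> P"
    proof (rule fock.subspace_sum[OF P])
      fix n assume n: "n \<in> {..K} - {1}"
      show "?f n \<in> P"
      proof (cases "n = 0")
        case False
        then show ?thesis using n by (intro sub(2) T_low) auto
      qed (simp add: sub(3))
    qed
    ultimately have "?f 1 \<in> P"
      using sum.remove[of "{..K}" 1 ?f] c(1) cancel by simp
    then have "bilinear_mode h k (of_nat (d + 0 + 2) - of_nat 1) (\<lambda>x. x gchoose d) (ket A) \<in> P"
      by (simp del: of_nat_Suc)
    moreover have "of_nat (d + 0 + 2) - of_nat 1 = (of_nat (Suc d) :: rat)" by simp
    moreover have "poly p = (\<lambda>x. x gchoose d)" using p by (rule ext)
    ultimately show "?Q p" by (simp only:)
  qed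
qed


text \<open>Applied with an \<open>f\<close> that vanishes at the unwanted pairs of creating modes:
  all other terms are subtracted and the nonzero value at \<open>m0\<close> is divided out.\<close>

lemma bilinear_mode_extract:
  assumes C: "finite C" and "bilinear_mode h k N f (ket C) \<in> P"
    and m0: "m0 \<in> half_modes" "f (- m0 - 1) \<noteq> 0"
    and rest: "\<And>m. m \<in> half_modes \<Longrightarrow> m \<noteq> m0 \<Longrightarrow> f (- m - 1) \<noteq> 0 \<Longrightarrow>
      nord [Mode h m, Mode k (- N - m)] (ket C) \<in> P"
  shows "nord [Mode h m0, Mode k (- N - m0)] (ket C) \<in> P"
proof -
  let ?g = "\<lambda>m. if m \<in> half_modes
     then scale (of_rat (f (- m - 1))) (nord [Mode h m, Mode k (- N - m)] (ket C)) else 0"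
  \<comment> \<open>The term at \<open>m0\<close> may itself vanish, so \<open>m0\<close> is
    adjoined to the support explicitly.\<close>
  let ?D = "insert m0 {m \<in> half_modes. nord [Mode h m, Mode k (- N - m)] (ket C) \<noteq> 0}"
  have fin: "finite ?D" using bilinear_mode_support[OF C] by (simp del: nord.simps)
  have "bilinear_mode h k N f (ket C) = sum ?g ?D"
    unfolding bilinear_mode_def using fin by (rule Sum_any.expand_superset) (auto simp del: nord.simps)
  also have "\<dots> = ?g m0 + sum ?g (?D - {m0})" by (rule sum.remove[OF fin]) simp
  finally have "?g m0 = bilinear_mode h k N f (ket C) - sum ?g (?D - {m0})" by simp
  also have "sum ?g (?D - {m0}) \<in> P"
  proof (rule fock.subspace_sum[OF P])
    fix m assume "m \<in> ?D - {m0}"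
    then show "?g m \<in> P"
      using rest[of m] P by (cases "f (- m - 1) = 0")
        (auto intro: fock.subspace_scale fock.subspace_0 simp del: nord.simps)
  qed
  then have "bilinear_mode h k N f (ket C) - sum ?g (?D - {m0}) \<in> P"
    using assms(2) P by (intro fock.subspace_diff)
  finally have "scale (of_rat (f (- m0 - 1))) (nord [Mode h m0, Mode k (- N - m0)] (ket C)) \<in> P"
    using m0(1) by (simp del: nord.simps)
  then have "scale (inverse (of_rat (f (- m0 - 1)))) (scale (of_rat (f (- m0 - 1)))
      (nord [Mode h m0, Mode k (- N - m0)] (ket C))) \<in> P"
    by (rule fock.subspace_scale[OF P])
  then show ?thesis using m0(2) by (simp del: nord.simps)
qed

end

section \<open>Reaching every basis vector from the generators\<close>

lemma negative_half_mode:
  assumes "m \<in> half_modes" "m < 0"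
  obtains i :: nat where "m = - (of_nat i + 1/2)"
proof -
  obtain z where z: "m - 1/2 = of_int z" using assms(1) by (auto simp: half_modes_def elim: Ints_cases)
  then have "of_int z < (0::rat)" using assms(2) by (simp add: field_simps)
  then have "z < 0" by simp
  then have "of_nat (nat (- z - 1)) = (of_int (- z - 1) :: rat)" by (simp add: of_nat_nat)
  then have "m = - (of_nat (nat (- z - 1)) + 1/2)" using z by (simp add: field_simps)
  then show thesis by (rule that)
qed

lemma negative_half_modeI: "- (of_nat i + 1/2) \<in> half_modes"
proof -
  have "- (of_nat i + 1/2) - 1/2 = (of_int (- int i - 1) :: rat)" by (simp add: field_simps)
  then show ?thesis unfolding half_modes_def by (metis Ints_of_int mem_Collect_eq)
qed

lemma act_vac_creation: "index x < 0 \<Longrightarrow> act x vac = ket {x}"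
  by (simp add: act_def create_def sgn_before_def)

text \<open>On \<open>h\<^bsub>(-1/2)\<^esub>|\<theta>\<rangle>\<close> the term with \<open>m = -1/2\<close> vanishes since \<open>h\<^bsub>(-1/2)\<^esub>\<close> squares to zero, so that
  a polynomial of degree \<open>N - 1\<close> suffices to remove all creating terms; what remains is
  \<open>h\<^bsub>(-N-1/2)\<^esub>k\<^bsub>(1/2)\<^esub>h\<^bsub>(-1/2)\<^esub>|\<theta>\<rangle>\<close>.\<close>

lemma (in bimodule_closed) one_particle:
  assumes "\<not> b" and base: "\<And>h. ket {Mode h (- 1/2)} \<in> P"
    and low: "\<And>B n. B \<in> sector half_modes b \<Longrightarrow> 1 \<le> n \<Longrightarrow>
      weight B = of_nat d + 1/2 - of_nat n \<Longrightarrow> ket B \<in> P"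
  shows "ket {Mode h (- (of_nat d + 1/2))} \<in> P"
proof (cases d)
  case 0 then show ?thesis using base by simp
next
  case (Suc e)
  \<comment> \<open>The auxiliary field must pair nontrivially with \<open>h\<close>, which is
    isotropic; this leaves the other basis vector.\<close>
  obtain k where k: "k \<noteq> h" by (cases h) auto
  let ?x = "Mode h (- 1/2)" and ?N = "of_nat (Suc e) :: rat"
  let ?C = "{?x}"
  let ?m = "- (of_nat d + 1/2) :: rat"
  have C: "?C \<in> sector half_modes b"
    using \<open>\<not> b\<close> negative_half_modeI[of 0] by (simp add: sector_def creation_modes_def)
  have wC: "weight ?C = 1/2" by (simp add: weight_def)
  \<comment> \<open>The mode \<open>m = -(l + 1/2)\<close> corresponds to
    \<open>x = l - 1/2\<close>, a root for \<open>l = 1, ..., e\<close>. Leaving out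
    \<open>l = 0\<close> keeps the degree at \<open>e\<close>, the bound in
    \<open>bilinear_mode_mem\<close> for the shift \<open>Suc e\<close>.\<close>
  define p :: "rat poly" where "p = (\<Prod>l = 1..e. [:1/2 - of_nat l, 1:])"
  have p: "poly p x = (\<Prod>l = 1..e. x + 1/2 - of_nat l)" for x
    by (simp add: p_def poly_prod algebra_simps)
  have "degree p \<le> sum (degree \<circ> (\<lambda>l. [:1/2 - of_nat l, 1 :: rat:])) {1..e}"
    unfolding p_def by (rule degree_prod_sum_le) simp
  then have "degree p \<le> e" by simp
  then have "bilinear_mode h k ?N (poly p) (ket ?C) \<in> P"
  proof (rule bilinear_mode_mem[OF C base, rotated])
    fix B n assume "B \<in> sector half_modes b" "1 \<le> n" "weight B = weight ?C + of_nat (Suc e) - of_nat n"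
    then show "ket B \<in> P" unfolding wC by (intro low[of B n]) (simp_all add: Suc)
  qed
  then have "nord [Mode h ?m, Mode k (- ?N - ?m)] (ket ?C) \<in> P"
  proof (rule bilinear_mode_extract[rotated])
    show "?m \<in> half_modes" by (rule negative_half_modeI)
    have "poly p (- ?m - 1) = (\<Prod>l = 1..e. of_nat d - of_nat l)"
      unfolding p by (intro prod.cong) auto
    then show "poly p (- ?m - 1) \<noteq> 0" using Suc by auto
  next
    fix m assume m: "m \<in> half_modes" "m \<noteq> ?m" "poly p (- m - 1) \<noteq> 0"
    consider "m > 0" | "m < 0" "- ?N - m \<ge> 0" | "m < 0" "- ?N - m < 0" | "m = 0" by linarith
    then have "nord [Mode h m, Mode k (- ?N - m)] (ket ?C) = 0"
    proof cases
      case 1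
      \<comment> \<open>By isotropy an annihilating mode of \<open>h\<close> contracts only with
        modes of \<open>k\<close>, and \<open>?C\<close> contains none.\<close>
      have "bracket (Mode h m) (Mode h (- m)) = 0" by (cases h) (simp_all add: bracket_def)
      moreover have "contract (Mode k (- m)) ?C = 0" using k by (simp add: contract_def)
      moreover have "h = E \<and> k = F \<or> h = F \<and> k = E" using k by (cases h; cases k) auto
      ultimately have "act (Mode h m) (ket ?C) = 0" using 1 by (auto simp: act_def)
      then show ?thesis using 1 by (simp add: nord_pair del: nord.simps)
    next
      case 2
      \<comment> \<open>The annihilating mode could contract only with index \<open>-1/2\<close>,
        which would force \<open>m = ?m\<close>.\<close>
      have "- (- ?N - m) \<noteq> - 1/2" using m(2) Suc by (auto simp: field_simps)
      then have "act (Mode k (- ?N - m)) (ket ?C) = 0"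
        using act_ket_nonzero[of "Mode k (- ?N - m)" ?C] 2 by auto
      then show ?thesis using 2 by (simp add: nord_pair del: nord.simps)
    next
      case 3
      obtain l where l: "m = - (of_nat l + 1/2)" using negative_half_mode[OF m(1) 3(1)] .
      have "of_nat l < (of_nat (Suc e) :: rat)" using 3 l by simp
      then have "l < Suc e" by (simp only: of_nat_less_iff)
      moreover have "l \<notin> {1..e}"
      proof
        assume "l \<in> {1..e}"
        then have "poly p (- m - 1) = 0" unfolding p l by (intro prod_zero) (auto intro!: bexI[of _ l])
        then show False using m(3) by simp
      qed
      ultimately have "l = 0" by auto
      then have x: "Mode h m = ?x" using l by simp
      \<comment> \<open>Two creating modes anticommute, so \<open>?x\<close> can be moved onto
        \<open>ket ?C\<close>, where it already occurs.\<close>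
      have "bracket ?x (Mode k (- ?N - m)) = 0" using l \<open>l = 0\<close> by (simp add: bracket_def)
      moreover have "act ?x (ket ?C) = 0" by (simp add: act_def create_def)
      ultimately have "act ?x (act (Mode k (- ?N - m)) (ket ?C)) = 0"
        using act_anticommute[OF sector_fock_space[OF C], of ?x "Mode k (- ?N - m)"] by simp
      then show ?thesis using 3 by (simp add: nord_pair x del: nord.simps)
    next
      case 4
      then show ?thesis using m(1)
        by (auto simp: half_modes_def elim!: Ints_cases)
    qed
    then show "nord [Mode h m, Mode k (- ?N - m)] (ket ?C) \<in> P"
      using fock.subspace_0[OF P] by (simp only:)
  qed simp
  moreover have "nord [Mode h ?m, Mode k (- ?N - ?m)] (ket ?C)
      = scale (bracket (Mode k (1/2)) ?x) (ket {Mode h ?m})"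
  proof -
    have "act (Mode k (1/2)) (act ?x vac) = scale (bracket (Mode k (1/2)) ?x) vac"
      using act_anticommute_finite_kets[OF vac_finite_kets, of "Mode k (1/2)" ?x] by (simp add: act_vac)
    moreover have "act ?x vac = ket ?C" by (rule act_vac_creation) simp
    moreover have "- ?N - ?m = 1/2" using Suc by simp
    moreover have "index (Mode h ?m) < 0" by simp
    ultimately show ?thesis
      unfolding nord_pair by (simp only: if_P act_scale act_vac_creation simp_thms if_True)
  qed
  ultimately have "scale (inverse (bracket (Mode k (1/2)) ?x)) (scale (bracket (Mode k (1/2)) ?x) (ket {Mode h ?m})) \<in> P"
    by (simp only: fock.subspace_scale[OF P])
  moreover have "bracket (Mode k (1/2)) ?x \<noteq> 0"
    using k by (cases h; cases k) (auto simp: bracket_def)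
  ultimately show ?thesis by simp
qed

text \<open>Two modes \<open>x\<close>, \<open>y\<close> of \<open>A\<close> are removed, which
  lowers the weight, and restored by a bilinear operator whose polynomial vanishes at all other
  creating pairs. The other surviving terms contain an annihilating mode, so they have the weight of
  \<open>A\<close> but fewer modes; hence the induction on weight, then length.\<close>

lemma (in bimodule_closed) ket_mem:
  assumes base0: "b \<Longrightarrow> vac \<in> P" and base1: "\<And>h. \<not> b \<Longrightarrow> ket {Mode h (- 1/2)} \<in> P"
    and "A \<in> sector half_modes b"
  shows "ket A \<in> P"
  using assms(3)
proof (induction A rule: wf_induct_rule[OF wf_measures[of "[\<lambda>A. nat \<lfloor>weight A\<rfloor>, card]"]])
  case (1 A)
  have low: "ket B \<in> P" if B: "B \<in> sector half_modes b" "1 \<le> n" "weight B = weight A - of_nat n" for B n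
  proof (rule 1(1)[OF _ B(1)])
    \<comment> \<open>Weights may be half-integral, but the drop \<open>n\<close> is a positive
      integer, so the floor decreases strictly.\<close>
    have "\<lfloor>weight B\<rfloor> = \<lfloor>weight A\<rfloor> - int n"
      unfolding B(3) by (metis floor_diff_of_int of_int_of_nat_eq)
    moreover have "0 \<le> \<lfloor>weight B\<rfloor>" using weight_nonneg[OF B(1)] by simp
    ultimately have "nat \<lfloor>weight B\<rfloor> < nat \<lfloor>weight A\<rfloor>" using B(2) by linarith
    then show "(B, A) \<in> measures [\<lambda>A. nat \<lfloor>weight A\<rfloor>, card]" by (rule measures_less)
  qed
  have same: "ket B \<in> P" if "B \<in> sector half_modes b" "weight B = weight A" "card B < card A" for B
    using that by (intro 1(1)) auto
  have A: "finite A" "A \<subseteq> creation_modes half_modes" "even (card A) = b"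
    using 1(2) by (auto simp: sector_def)
  have half: "\<exists>i::nat. index x = - (of_nat i + 1/2)" if "x \<in> A" for x
    using that A(2) negative_half_mode[of "index x"] by (auto simp: creation_modes_def)
  consider "card A = 0" | "card A = 1" | "card A \<ge> 2" by linarith
  then show ?case
  proof cases
    case 1 then show ?thesis using A base0 by auto
  next
    case 2
    then obtain x where x: "A = {x}" by (metis card_1_singletonE)
    then obtain d :: nat where "index x = - (of_nat d + 1/2)" using half by auto
    then have A_eq: "A = {Mode (kind x) (- (of_nat d + 1/2))}" using x by (cases x) simp
    then have w: "weight A = of_nat d + 1/2" by (simp add: weight_def)
    show ?thesis unfolding A_eq
      by (rule one_particle) (use A 2 base1 low w in auto)
  next
    case 3
    then obtain x where x: "x \<in> A" by fastforce
    have "card (A - {x}) \<ge> 1" using 3 x A(1) by simp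
    then obtain y where y: "y \<in> A" "y \<noteq> x" by (metis DiffE card.empty ex_in_conv insertI1 not_one_le_zero)
    let ?C = "A - {x} - {y}"
    obtain i j :: nat where ij: "index x = - (of_nat i + 1/2)" "index y = - (of_nat j + 1/2)"
      using half x y by blast
    let ?N = "of_nat (Suc (i + j)) :: rat"
    have wC: "weight ?C = weight A - ?N"
      using A(1) x y by (simp add: weight_remove ij)
    have card: "card A = Suc (Suc (card ?C))" using A(1) x y 3 by (simp add: card_Diff_singleton)
    then have C: "?C \<in> sector half_modes b" using A by (auto simp: sector_def)
    \<comment> \<open>Creating pairs of total index \<open>- ?N\<close> are those with
      \<open>m = -(l + 1/2)\<close>, \<open>l \<le> i + j\<close>. All but \<open>l = i\<close>
      become roots, and the degree \<open>i + j\<close> is the largest that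
      \<open>bilinear_mode_mem\<close> allows for \<open>?N\<close>.\<close>
    define p :: "rat poly" where "p = (\<Prod>l\<in>{..i + j} - {i}. [:1/2 - of_nat l, 1:])"
    have p: "poly p x = (\<Prod>l\<in>{..i + j} - {i}. x + 1/2 - of_nat l)" for x
      by (simp add: p_def poly_prod algebra_simps)
    have "degree p \<le> sum (degree \<circ> (\<lambda>l. [:1/2 - of_nat l, 1 :: rat:])) ({..i + j} - {i})"
      unfolding p_def by (rule degree_prod_sum_le) simp
    then have deg: "degree p \<le> i + j" by simp
    have "ket ?C \<in> P" by (rule low[OF C, of "Suc (i + j)"]) (use wC in simp_all)
    then have "bilinear_mode (kind x) (kind y) ?N (poly p) (ket ?C) \<in> P"
    proof (rule bilinear_mode_mem[OF C _ _ deg])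
      fix B n assume "B \<in> sector half_modes b" "1 \<le> n" "weight B = weight ?C + ?N - of_nat n"
      then show "ket B \<in> P" unfolding wC by (intro low[of B n]) simp_all
    qed
    then have "nord [Mode (kind x) (index x), Mode (kind y) (- ?N - index x)] (ket ?C) \<in> P"
    proof (rule bilinear_mode_extract[rotated])
      show "index x \<in> half_modes" unfolding ij by (rule negative_half_modeI)
      show "poly p (- index x - 1) \<noteq> 0" unfolding p ij by auto
    next
      fix m assume m: "m \<in> half_modes" "m \<noteq> index x" "poly p (- m - 1) \<noteq> 0"
      have "\<not> (m < 0 \<and> - ?N - m < 0)"
      proof
        assume neg: "m < 0 \<and> - ?N - m < 0"
        then obtain l where l: "m = - (of_nat l + 1/2)" using negative_half_mode[OF m(1)] by blast
        have "of_nat l < (of_nat (Suc (i + j)) :: rat)" using neg l by simp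
        then have "l < Suc (i + j)" by (simp only: of_nat_less_iff)
        moreover have "l \<noteq> i" using m(2) l ij by auto
        ultimately have "poly p (- m - 1) = 0"
          unfolding p l by (intro prod_zero) (auto intro!: bexI[of _ l])
        then show False using m(3) by simp
      qed
      moreover have "- ?N - m \<in> half_modes" using half_modes_reflect[of ?N m] m(1) by simp
      ultimately have "nord [Mode (kind x) m, Mode (kind y) (- ?N - m)] (ket ?C)
          \<in> ket_space {B \<in> sector half_modes b. weight B = weight A \<and> card B \<le> card ?C}"
        using nord_pair_ket[OF C, of "Mode (kind x) m" "Mode (kind y) (- ?N - m)"] m(1) wC
        by (simp add: ket_space_def del: nord.simps of_nat_Suc) (auto simp del: nord.simps of_nat_Suc)
      moreover have "\<dots> \<subseteq> P"
        using card by (intro ket_space_subset[OF P]) (auto intro: same)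
      ultimately show "nord [Mode (kind x) m, Mode (kind y) (- ?N - m)] (ket ?C) \<in> P" by blast
    qed (use A in simp)
    moreover have "- ?N - index x = index y" by (simp add: ij)
    ultimately have "nord [x, y] (ket ?C) \<in> P" by (simp only: mode.collapse)
    moreover have "index x < 0" by (simp add: ij)
    ultimately have mem: "act x (act y (ket ?C)) \<in> P" by (simp only: nord_pair if_True)
    have "insert y ?C = A - {x}" "insert x (A - {x}) = A" using x y by auto
    then have "act x (act y (ket ?C)) = scale (sgn_before x (A - {x}) * sgn_before y ?C) (ket A)"
      using ij x y by (auto simp: act_def create_def lin_scale mult.commute)
    \<comment> \<open>Both signs square to 1, so multiplying by them again recovers
      \<open>ket A\<close>.\<close>
    then have "scale (sgn_before y ?C) (scale (sgn_before x (A - {x})) (act x (act y (ket ?C)))) = ket A"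
      by (simp add: ac_simps)
    then show ?thesis using mem fock.subspace_scale[OF P] by metis
  qed
qed

text \<open>\<open>bimodule_span_eqI\<close> replaces generation modulo O(M) by generation of the
  sector itself, which \<open>ket_mem\<close> supplies. The parity decides whether
  \<open>vac\<close> or the two vectors with a single mode of index \<open>-1/2\<close> form the
  base case.\<close>

theorem proposition4p2:
  shows "bimodule_span Y_theta_mode Tt_plus {Zhu_class Y_theta_mode Tt_plus vac}
           = Zhu_A Y_theta_mode Tt_plus
       \<and> bimodule_span Y_theta_mode Tt_minus
           {Zhu_class Y_theta_mode Tt_minus (act (Mode E (-1/2)) vac),
            Zhu_class Y_theta_mode Tt_minus (act (Mode F (-1/2)) vac)}
           = Zhu_A Y_theta_mode Tt_minus"
proof
  have plus: "Tt_plus = ket_space (sector half_modes True)"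
    and minus: "Tt_minus = ket_space (sector half_modes False)"
    by (simp_all add: Tt_plus_def Tt_minus_def fock_even_eq fock_odd_eq)
  have closed: "\<forall>a\<in>T_plus. \<forall>u\<in>ket_space (sector half_modes b). \<forall>n.
      Y_theta_mode a n u \<in> ket_space (sector half_modes b)" for b
    by (simp add: Y_theta_mode_sector)
  have "bimodule_span Y_theta_mode Tt_plus (Zhu_class Y_theta_mode Tt_plus ` {vac}) = Zhu_A Y_theta_mode Tt_plus"
    unfolding plus
  proof (rule bimodule_span_eqI[OF subspace_ket_space closed])
    show "{vac} \<subseteq> ket_space (sector half_modes True)" by (simp add: sector_def)
    fix P assume *: "fock.subspace P" "{vac} \<subseteq> P"
      "\<forall>a\<in>T_plus. \<forall>u\<in>P. star_left Y_theta_mode a u \<in> P"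
      "\<forall>a\<in>T_plus. \<forall>u\<in>P. star_right Y_theta_mode u a \<in> P"
    interpret bimodule_closed P True by (rule bimodule_closed.intro[OF *(1,3,4)])
    show "ket_space (sector half_modes True) \<subseteq> P"
    proof (rule ket_space_subset[OF *(1)])
      fix A assume "A \<in> sector half_modes True"
      then show "ket A \<in> P" by (rule ket_mem[rotated 2]) (use *(2) in simp_all)
    qed
  qed
  then show "bimodule_span Y_theta_mode Tt_plus {Zhu_class Y_theta_mode Tt_plus vac}
      = Zhu_A Y_theta_mode Tt_plus" by simp
  let ?G = "{act (Mode E (-1/2)) vac, act (Mode F (-1/2)) vac}"
  have one: "act (Mode h (-1/2)) vac = ket {Mode h (-1/2)}" for h
    by (rule act_vac_creation) simp
  have "bimodule_span Y_theta_mode Tt_minus (Zhu_class Y_theta_mode Tt_minus ` ?G) = Zhu_A Y_theta_mode Tt_minus"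
    unfolding minus
  proof (rule bimodule_span_eqI[OF subspace_ket_space closed])
    show "?G \<subseteq> ket_space (sector half_modes False)"
      unfolding one using negative_half_modeI[of 0] by (simp add: sector_def creation_modes_def)
    fix P assume *: "fock.subspace P" "?G \<subseteq> P"
      "\<forall>a\<in>T_plus. \<forall>u\<in>P. star_left Y_theta_mode a u \<in> P"
      "\<forall>a\<in>T_plus. \<forall>u\<in>P. star_right Y_theta_mode u a \<in> P"
    interpret bimodule_closed P False by (rule bimodule_closed.intro[OF *(1,3,4)])
    have base: "ket {Mode h (-1/2)} \<in> P" for h
      using *(2) unfolding one by (cases h) auto
    show "ket_space (sector half_modes False) \<subseteq> P"
    proof (rule ket_space_subset[OF *(1)])
      fix A assume "A \<in> sector half_modes False"
      then show "ket A \<in> P" by (rule ket_mem[rotated 2]) (use base in simp_all)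
    qed
  qed
  then show "bimodule_span Y_theta_mode Tt_minus
      {Zhu_class Y_theta_mode Tt_minus (act (Mode E (-1/2)) vac),
       Zhu_class Y_theta_mode Tt_minus (act (Mode F (-1/2)) vac)}
      = Zhu_A Y_theta_mode Tt_minus" by simp
qed

end
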